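(* Let $\mathcal M=\mathbb S^n$ be the unit sphere with the round metric, $N\ge 2$, $R>0$, and let $\mu=\mathrm{Unif}((\mathbb S^n)^N)$ be the uniform probability distribution on $(\mathbb S^n)^N$. Let $\rho$ and $A$ be as defined in the context. Then for every nontrivial linear subspace $\mathcal H\subset L^2([0,R];\rho;\mathbb R)$, $$\inf_{\varphi\in\mathcal H,\ \varphi\neq0}\frac{\|A\varphi\|_{L^2(\mu)}}{\|\varphi\|_{L^2(\rho)}}=\frac{\sqrt{N-1}}{N}.$$
   Context: Let $g$ be the round metric on $\mathcal M=\mathbb S^n\subset\mathbb R^{n+1}$, with distance $d(\mathbf x,\mathbf y)=\arccos\langle\mathbf x,\mathbf y\rangle$; the cut locus of $\mathbf x$ is $\{-\mathbf x\}$. The influence vector $w(\mathbf x,\mathbf y)\in T_{\mathbf x}\mathcal M$ is $w(\mathbf x,\mathbf y)=d(\mathbf x,\mathbf y)\,\dot\gamma_{\mathbf x,\mathbf y}(0)$ if $\mathbf y\ne\pm\mathbf x$, where $\gamma_{\mathbf x,\mathbf y}$ is the unique unit-speed minimizing geodesic from $\mathbf x$ to $\mathbf y$, and $w(\mathbf x,\mathbf y)=0$ otherwise. The tangent space $T_{\mathbf X}\mathcal M^N=T_{\mathbf x_1}\mathcal M\times\cdots\times T_{\mathbf x_N}\mathcal M$ of the product manifold carries the weighted inner product $\langle (\mathbf u_i)_i,(\mathbf v_i)_i\rangle=\frac1N\sum_{i=1}^N g(\mathbf u_i,\mathbf v_i)$, and for a measurable vector field $F$ on $\mathcal M^N$,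 $\|F\|_{L^2(\mu)}^2=\int_{\mathcal M^N}\|F(\mathbf X)\|^2_{T_{\mathbf X}\mathcal M^N}\,d\mu(\mathbf X)$. For $\varphi:[0,R]\to\mathbb R$, extended by $0$ to $\mathbb R^+=[0,\infty)$, $\mathbf f_\varphi$ is the vector field on $\mathcal M^N$ whose $i$-th component at $\mathbf X=(\mathbf x_1,\dots,\mathbf x_N)$ is $\frac1N\sum_{j=1}^N\varphi(d(\mathbf x_i,\mathbf x_j))\,w(\mathbf x_i,\mathbf x_j)$, and $A\varphi:=\mathbf f_\varphi$. With $P_{ij}(\mathbf X)=d(\mathbf x_i,\mathbf x_j)$, the measure $\rho$ on Borel sets $B\subset\mathbb R^+$ is $\rho(B)=\frac{1}{N(N-1)}\sum_{i\ne j}\int_{P_{ij}^{-1}(B)}P_{ij}^2(\mathbf X)\,d\mu(\mathbf X)$ (sum over ordered pairs of distinct indices). $L^2([0,R];\rho;\mathbb R)$ uses the restriction of $\rho$ to $[0,R]$, with norm $\|\cdot\|_{L^2(\rho)}$; "$\varphi\ne 0$" means nonzero as an element of this space. *)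

theory Defs
  imports "HOL-Analysis.Analysis"
begin

text \<open>
  The sphere \<open>S^n\<close> is \<^term>\<open>sphere 0 1\<close> in a Euclidean space \<open>'a\<close> of dimension \<open>n + 1\<close>, and the round
  metric is the restriction of the ambient inner product to the tangent spaces. Indices of points
  run over \<^term>\<open>{..<N}\<close>.
\<close>

definition sphere_dist :: "'a::euclidean_space \<Rightarrow> 'a \<Rightarrow> real" where
  "sphere_dist x y = arccos (x \<bullet> y)"

text \<open>
  Unit-speed minimizing geodesics \<open>\<gamma> : [0, d(x,y)] \<rightarrow> S^n\<close> from \<open>x\<close> to \<open>y\<close>. The covariant acceleration
  on the sphere is the projection of the ambient acceleration onto the tangent space
  \<open>T_p S^n = p\<^sup>\<bottom>\<close>, \<open>p = \<gamma>(t)\<close>; for a geodesic it vanishes. Having unit speed on an interval of length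
  \<open>d(x,y)\<close>, the curve has length \<open>d(x,y)\<close>, that is, it is minimizing.
\<close>
definition unit_speed_minimizing_geodesic :: "'a::euclidean_space \<Rightarrow> 'a \<Rightarrow> (real \<Rightarrow> 'a) \<Rightarrow> bool" where
  "unit_speed_minimizing_geodesic x y \<gamma> \<longleftrightarrow>
     (let I = {0..sphere_dist x y} in
      \<gamma> 0 = x \<and> \<gamma> (sphere_dist x y) = y \<and>
      (\<exists>\<gamma>' \<gamma>''. \<forall>t\<in>I.
         \<gamma> t \<in> sphere 0 1 \<and>
         (\<gamma> has_vector_derivative \<gamma>' t) (at t within I) \<and>
         (\<gamma>' has_vector_derivative \<gamma>'' t) (at t within I) \<and>
         norm (\<gamma>' t) = 1 \<and>
         \<gamma>'' t - (\<gamma>'' t \<bullet> \<gamma> t) *\<^sub>R \<gamma> t = 0))"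

text \<open>
  For \<open>y \<noteq> \<plusminus>x\<close> the geodesic is unique on \<open>[0, d(x,y)]\<close>; its values elsewhere are unconstrained and
  do not affect the derivative at \<open>0\<close> within that interval.
\<close>
definition influence_vector :: "'a::euclidean_space \<Rightarrow> 'a \<Rightarrow> 'a" where
  "influence_vector x y =
     (if y \<noteq> x \<and> y \<noteq> - x
      then sphere_dist x y *\<^sub>R
             vector_derivative (SOME \<gamma>. unit_speed_minimizing_geodesic x y \<gamma>)
               (at 0 within {0..sphere_dist x y})
      else 0)"

text \<open>
  Normalized surface measure, defined as the cone measure: the law of \<open>x / \<parallel>x\<parallel>\<close> for \<open>x\<close> uniform in the unit
  ball. The set \<open>{0}\<close>, where \<^term>\<open>sgn\<close> leaves the sphere, is null, so the restriction to the sphere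
  loses no mass.
\<close>
definition uniform_sphere :: "'a::euclidean_space measure" where
  "uniform_sphere =
     restrict_space (distr (uniform_measure lborel (ball 0 1)) borel sgn) (sphere 0 1)"

definition uniform_sphere_power :: "nat \<Rightarrow> (nat \<Rightarrow> 'a::euclidean_space) measure" where
  "uniform_sphere_power N = (\<Pi>\<^sub>M i\<in>{..<N}. uniform_sphere)"

definition tangent_norm :: "nat \<Rightarrow> (nat \<Rightarrow> 'a::euclidean_space) \<Rightarrow> real" where
  "tangent_norm N v = sqrt ((1 / real N) * (\<Sum>i<N. v i \<bullet> v i))"

definition vector_field_L2_norm ::
    "nat \<Rightarrow> (nat \<Rightarrow> 'a::euclidean_space) measure \<Rightarrow> ((nat \<Rightarrow> 'a) \<Rightarrow> nat \<Rightarrow> 'a) \<Rightarrow> real" where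
  "vector_field_L2_norm N \<mu> F = sqrt (\<integral>X. (tangent_norm N (F X))\<^sup>2 \<partial>\<mu>)"

definition extend_by_zero :: "real \<Rightarrow> (real \<Rightarrow> real) \<Rightarrow> real \<Rightarrow> real" where
  "extend_by_zero R \<phi> r = (if r \<in> {0..R} then \<phi> r else 0)"

text \<open>The operator \<open>\<phi> \<mapsto> f\<^sub>\<phi>\<close>.\<close>
definition interaction_field ::
    "nat \<Rightarrow> real \<Rightarrow> (real \<Rightarrow> real) \<Rightarrow> (nat \<Rightarrow> 'a::euclidean_space) \<Rightarrow> nat \<Rightarrow> 'a" where
  "interaction_field N R \<phi> X i =
     (1 / real N) *\<^sub>R
       (\<Sum>j<N. extend_by_zero R \<phi> (sphere_dist (X i) (X j)) *\<^sub>R influence_vector (X i) (X j))"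

definition pair_distance_measure ::
    "nat \<Rightarrow> (nat \<Rightarrow> 'a::euclidean_space) measure \<Rightarrow> real measure" where
  "pair_distance_measure N \<mu> =
     measure_of {0..} (sets (restrict_space borel {0..}))
       (\<lambda>B. ennreal (1 / (real N * (real N - 1))) *
          (\<Sum>(i, j)\<in>{(i, j). i < N \<and> j < N \<and> i \<noteq> j}.
             \<integral>\<^sup>+X\<in>{X \<in> space \<mu>. sphere_dist (X i) (X j) \<in> B}.
               ennreal ((sphere_dist (X i) (X j))\<^sup>2) \<partial>\<mu>))"

text \<open>
  Elements of \<open>L\<^sup>2([0,R]; \<rho>)\<close> are represented by square-integrable functions; only the values on
  \<open>[0,R]\<close> matter. Being zero in \<open>L\<^sup>2\<close> is being zero almost everywhere, and a subspace of \<open>L\<^sup>2\<close> is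
  represented by a linear space of representatives: the full preimage of any subspace of \<open>L\<^sup>2\<close>
  has this form, and conversely the classes of such functions form a subspace.
\<close>
definition L2_space :: "real \<Rightarrow> real measure \<Rightarrow> (real \<Rightarrow> real) set" where
  "L2_space R \<rho> = {\<phi> \<in> borel_measurable (restrict_space \<rho> {0..R}).
                     integrable (restrict_space \<rho> {0..R}) (\<lambda>r. (\<phi> r)\<^sup>2)}"

definition L2_norm :: "real \<Rightarrow> real measure \<Rightarrow> (real \<Rightarrow> real) \<Rightarrow> real" where
  "L2_norm R \<rho> \<phi> = sqrt (\<integral>r. (\<phi> r)\<^sup>2 \<partial>(restrict_space \<rho> {0..R}))"

definition L2_zero :: "real \<Rightarrow> real measure \<Rightarrow> (real \<Rightarrow> real) \<Rightarrow> bool" where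
  "L2_zero R \<rho> \<phi> \<longleftrightarrow> (AE r in restrict_space \<rho> {0..R}. \<phi> r = 0)"

definition L2_subspace :: "real \<Rightarrow> real measure \<Rightarrow> (real \<Rightarrow> real) set \<Rightarrow> bool" where
  "L2_subspace R \<rho> H \<longleftrightarrow>
     H \<subseteq> L2_space R \<rho> \<and>
     (\<lambda>r. 0) \<in> H \<and>
     (\<forall>\<phi>\<in>H. \<forall>\<psi>\<in>H. (\<lambda>r. \<phi> r + \<psi> r) \<in> H) \<and>
     (\<forall>c. \<forall>\<phi>\<in>H. (\<lambda>r. c * \<phi> r) \<in> H)"

end

theory Submission
  imports Defs
begin

text \<open>
  The quotient is the same for every \<open>\<phi> \<noteq> 0\<close>. Expand \<open>\<parallel>A\<phi>\<parallel>\<^sup>2\<close> into integrals of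
  \<open>\<phi>(d\<^sub>i\<^sub>j) \<phi>(d\<^sub>i\<^sub>k) \<langle>w\<^sub>i\<^sub>j, w\<^sub>i\<^sub>k\<rangle>\<close>. For \<open>j \<noteq> k\<close> they vanish: the reflection of \<open>x\<^sub>k\<close> in the axis through
  \<open>x\<^sub>i\<close> preserves \<open>\<mu>\<close> and \<open>d\<^sub>i\<^sub>k\<close> but reverses \<open>w\<^sub>i\<^sub>k\<close>. Since \<open>\<parallel>w\<^sub>i\<^sub>j\<parallel> = d\<^sub>i\<^sub>j\<close> away from antipodal pairs,
  the diagonal terms sum to \<open>(N - 1) / N\<^sup>2\<close> times \<open>\<parallel>\<phi>\<parallel>\<^sup>2\<close>.
\<close>

subsection \<open>Influence vectors\<close>

text \<open>Both norms reduce to the same sum S of integrals of \<open>pair_energy\<close> over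
  ordered pairs. The field contributes 1/N twice and the tangent inner product once more, so the
  squared norm of the field is S / N^3; the normalisation of \<open>\<rho>\<close> gives S / (N (N -
  1)) for the function. Their quotient is (N - 1) / N^2 for every S other than 0.

  The obstacles lie in the definitions. The influence vector rests on a choice of geodesic, so
  existence of a geodesic and uniqueness of its initial velocity must come before any computation.
  The surface measure is a projection of Lebesgue measure, and its symmetry has to be drawn from
  there. Antipodal pairs, where w is 0 but d is pi, form a null set because n is at least 1; on a
  0-dimensional sphere they would have positive probability. Finally, integrals of sums split only
  for integrable terms, and integrability must be extracted from the square integrability of
  \<open>\<phi>\<close>. Terms in which a point acts on itself drop out since w(x, x) = 0.\<close>

lemma unit_inner_bounds:
  fixes x y :: "'a::euclidean_space"
  assumes "norm x = 1" "norm y = 1"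
  shows "x \<bullet> y \<le> 1" "-1 \<le> x \<bullet> y"
  using Cauchy_Schwarz_ineq2[of x y] assms by auto

lemma unit_inner_eq_1_iff:
  fixes x y :: "'a::euclidean_space"
  assumes "norm x = 1" "norm y = 1"
  shows "x \<bullet> y = 1 \<longleftrightarrow> y = x"
proof -
  have "(norm (x - y))\<^sup>2 = 2 - 2 * (x \<bullet> y)"
    using assms by (simp add: power2_norm_eq_inner inner_diff inner_commute norm_eq_1)
  then show ?thesis by auto
qed

lemma unit_inner_eq_minus_1_iff:
  fixes x y :: "'a::euclidean_space"
  assumes "norm x = 1" "norm y = 1"
  shows "x \<bullet> y = -1 \<longleftrightarrow> y = - x"
  using unit_inner_eq_1_iff[of x "-y"] assms by (auto simp: minus_equation_iff)

lemma norm_unit_component_sq: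
  fixes x y :: "'a::euclidean_space"
  assumes "norm x = 1" "norm y = 1"
  shows "(norm (y - (x \<bullet> y) *\<^sub>R x))\<^sup>2 = 1 - (x \<bullet> y)\<^sup>2"
  using assms
  by (simp add: power2_norm_eq_inner inner_diff inner_commute norm_eq_1)
     (simp add: power2_eq_square inner_commute)

text \<open>The witness is the great circle through \<open>x\<close> with initial velocity
  \<open>v\<close>, the component of \<open>y\<close> orthogonal to \<open>x\<close> divided by its
  length \<open>sin d\<close>. Existence ensures that the \<open>SOME\<close> in
  \<open>influence_vector\<close> denotes a geodesic.\<close>

lemma unit_speed_minimizing_geodesic_exists:
  fixes x y :: "'a::euclidean_space"
  assumes x: "norm x = 1" and y: "norm y = 1" and ne: "y \<noteq> x" "y \<noteq> - x"
  shows "\<exists>\<gamma>. unit_speed_minimizing_geodesic x y \<gamma>"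
proof -
  define c where "c = x \<bullet> y"
  define d where "d = sphere_dist x y"
  define v where "v = (1 / sin d) *\<^sub>R (y - c *\<^sub>R x)"
  have c: "-1 < c" "c < 1"
    using unit_inner_bounds[OF x y] unit_inner_eq_1_iff[OF x y] unit_inner_eq_minus_1_iff[OF x y] ne
    by (auto simp: c_def less_le)
  have cd: "cos d = c" and d: "0 < d" "d < pi"
    using c arccos_lt_bounded[of c] by (auto simp: d_def sphere_dist_def c_def)
  have sd: "sin d > 0" using d by (rule sin_gt_zero)
  have "(norm (y - c *\<^sub>R x))\<^sup>2 = (sin d)\<^sup>2"
    using norm_unit_component_sq[OF x y] cd by (simp add: c_def sin_squared_eq)
  then have "norm (y - c *\<^sub>R x) = sin d"
    using sd by (simp add: power2_eq_iff_nonneg)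
  then have "norm v = 1" using sd by (simp add: v_def)
  then have v1: "v \<bullet> v = 1" by (simp only: norm_eq_1)
  have xx: "x \<bullet> x = 1" using x by (simp add: norm_eq_1)
  have xv: "x \<bullet> v = 0" "v \<bullet> x = 0"
    using xx by (auto simp: v_def inner_diff c_def inner_commute)
  let ?g = "\<lambda>t. cos t *\<^sub>R x + sin t *\<^sub>R v"
  let ?g' = "\<lambda>t. (- sin t) *\<^sub>R x + cos t *\<^sub>R v"
  have sc: "cos t * cos t + sin t * sin t = 1" "sin t * sin t + cos t * cos t = 1" for t :: real
    using sin_cos_squared_add[of t] by (auto simp: power2_eq_square)
  have n1: "norm (?g t) = 1" "norm (?g' t) = 1" for t
    using sc[of t] by (auto simp: norm_eq_1 inner_add inner_diff xx xv v1)
  have gg: "?g t \<bullet> ?g t = 1" for t using n1(1)[of t] by (simp only: norm_eq_1)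
  have "(?g has_vector_derivative ?g' t) (at t within {0..d})" for t
    using has_vector_derivative_add[OF
      has_vector_derivative_scaleR[OF DERIV_subset[OF DERIV_cos] has_vector_derivative_const]
      has_vector_derivative_scaleR[OF DERIV_subset[OF DERIV_sin] has_vector_derivative_const]] by simp
  moreover have "(?g' has_vector_derivative - ?g t) (at t within {0..d})" for t
    using has_vector_derivative_add[OF
      has_vector_derivative_scaleR[OF DERIV_minus[OF DERIV_subset[OF DERIV_sin]] has_vector_derivative_const]
      has_vector_derivative_scaleR[OF DERIV_subset[OF DERIV_cos] has_vector_derivative_const]] by simp
  moreover have "- ?g t - (- ?g t \<bullet> ?g t) *\<^sub>R ?g t = 0" for t
    by (simp only: inner_minus_left gg) simp
  moreover have "?g t \<in> sphere 0 1" for t using n1(1)[of t] by (simp only: mem_sphere_0)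
  ultimately have "\<exists>\<gamma>' \<gamma>''. \<forall>t\<in>{0..d}. ?g t \<in> sphere 0 1 \<and>
         (?g has_vector_derivative \<gamma>' t) (at t within {0..d}) \<and>
         (\<gamma>' has_vector_derivative \<gamma>'' t) (at t within {0..d}) \<and>
         norm (\<gamma>' t) = 1 \<and> \<gamma>'' t - (\<gamma>'' t \<bullet> ?g t) *\<^sub>R ?g t = 0"
    using n1(2) by - (rule exI[where x="?g'"], rule exI[where x="\<lambda>t. - ?g t"], intro ballI conjI)
  moreover have "?g 0 = x" "?g d = y" using sd by (simp_all add: cd v_def)
  ultimately have "unit_speed_minimizing_geodesic x y ?g"
    unfolding unit_speed_minimizing_geodesic_def Let_def d_def[symmetric] by (intro conjI)
  then show ?thesis by blast
qed

text \<open>Unit speed turns the geodesic equation into the linear equation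
  \<open>\<gamma>'' = - \<gamma>\<close>, whose solutions are determined by their end points when
  \<open>0 < d < pi\<close>. Hence the chosen geodesic has no influence on the initial
  velocity.\<close>

lemma unit_speed_minimizing_geodesic_initial_velocity:
  fixes x y :: "'a::euclidean_space"
  assumes x: "norm x = 1" and y: "norm y = 1" and ne: "y \<noteq> x" "y \<noteq> - x"
    and geo: "unit_speed_minimizing_geodesic x y \<gamma>"
  shows "vector_derivative \<gamma> (at 0 within {0..sphere_dist x y})
         = (1 / sqrt (1 - (x \<bullet> y)\<^sup>2)) *\<^sub>R (y - (x \<bullet> y) *\<^sub>R x)"
proof -
  define c where "c = x \<bullet> y"
  define d where "d = sphere_dist x y"
  have c: "-1 < c" "c < 1"
    using unit_inner_bounds[OF x y] unit_inner_eq_1_iff[OF x y] unit_inner_eq_minus_1_iff[OF x y] ne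
    by (auto simp: c_def less_le)
  have cd: "cos d = c" and d: "0 < d" "d < pi"
    using c arccos_lt_bounded[of c] by (auto simp: d_def sphere_dist_def c_def)
  have sd: "sin d > 0" using d by (rule sin_gt_zero)
  have sd': "sin d = sqrt (1 - c\<^sup>2)" using c by (simp add: d_def sphere_dist_def c_def sin_arccos)
  obtain \<gamma>' \<gamma>'' where g0: "\<gamma> 0 = x" "\<gamma> d = y"
    and g: "\<And>t. t \<in> {0..d} \<Longrightarrow> norm (\<gamma> t) = 1"
      "\<And>t. t \<in> {0..d} \<Longrightarrow> (\<gamma> has_vector_derivative \<gamma>' t) (at t within {0..d})"
      "\<And>t. t \<in> {0..d} \<Longrightarrow> (\<gamma>' has_vector_derivative \<gamma>'' t) (at t within {0..d})"
      "\<And>t. t \<in> {0..d} \<Longrightarrow> norm (\<gamma>' t) = 1"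
      "\<And>t. t \<in> {0..d} \<Longrightarrow> \<gamma>'' t = (\<gamma>'' t \<bullet> \<gamma> t) *\<^sub>R \<gamma> t"
  proof -
    obtain \<gamma>' \<gamma>'' where "\<gamma> 0 = x" "\<gamma> d = y" "\<forall>t\<in>{0..d}. \<gamma> t \<in> sphere 0 1 \<and>
         (\<gamma> has_vector_derivative \<gamma>' t) (at t within {0..d}) \<and>
         (\<gamma>' has_vector_derivative \<gamma>'' t) (at t within {0..d}) \<and>
         norm (\<gamma>' t) = 1 \<and> \<gamma>'' t - (\<gamma>'' t \<bullet> \<gamma> t) *\<^sub>R \<gamma> t = 0"
      using geo unfolding unit_speed_minimizing_geodesic_def Let_def d_def[symmetric] by blast
    then show thesis by (intro that[of \<gamma>' \<gamma>'']) simp_all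
  qed
  \<comment> \<open>Derivatives within \<open>{0..d}\<close> are unique, also at the end points,
    because \<open>d > 0\<close>.\<close>
  have deriv_const: "D = 0"
    if "\<And>t. t \<in> {0..d} \<Longrightarrow> f t = k" "(f has_vector_derivative D) (at t within {0..d})" "t \<in> {0..d}"
    for f :: "real \<Rightarrow> real" and k D t
  proof -
    have "(f has_vector_derivative 0) (at t within {0..d})"
      using that by (intro has_vector_derivative_transform[OF _ _ has_vector_derivative_const[of k]]) auto
    then show ?thesis using vector_derivative_unique_within_closed_interval[of 0 d t f D 0] that(2,3) d by auto
  qed
  have inner_deriv: "((\<lambda>t. f t \<bullet> h t) has_vector_derivative (f t \<bullet> h' + f' \<bullet> h t)) (at t within S)"
    if "(f has_vector_derivative f') (at t within S)" "(h has_vector_derivative h') (at t within S)"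
    for f h :: "real \<Rightarrow> 'a" and f' h' t S
    using bounded_bilinear.has_vector_derivative[OF bounded_bilinear_inner that] .
  \<comment> \<open>Differentiate the constant
    \<open>\<gamma> t \<bullet> \<gamma> t = 1\<close>.\<close>
  have orth: "\<gamma> t \<bullet> \<gamma>' t = 0" if t: "t \<in> {0..d}" for t
    using deriv_const[OF _ inner_deriv[OF g(2)[OF t] g(2)[OF t]] t, of 1] g(1)
    by (simp add: norm_eq_1 inner_commute)
  \<comment> \<open>Differentiating \<open>orth\<close> gives the normal coefficient:
    \<open>\<gamma>'' t \<bullet> \<gamma> t\<close> is minus the squared speed, that is -1.\<close>
  have ode: "\<gamma>'' t = - \<gamma> t" if t: "t \<in> {0..d}" for t
  proof -
    have "\<gamma> t \<bullet> \<gamma>'' t + \<gamma>' t \<bullet> \<gamma>' t = 0"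
      using deriv_const[OF _ inner_deriv[OF g(2)[OF t] g(3)[OF t]] t, of 0] orth by simp
    then have "\<gamma>'' t \<bullet> \<gamma> t = -1" using g(4)[OF t] by (simp add: norm_eq_1 inner_commute)
    then show ?thesis using g(5)[OF t] by simp
  qed
  \<comment> \<open>First integrals of \<open>\<gamma>'' = - \<gamma>\<close>: both combinations below are constant along the curve.\<close>
  let ?h = "\<lambda>t. cos t *\<^sub>R \<gamma> t - sin t *\<^sub>R \<gamma>' t"
  let ?k = "\<lambda>t. sin t *\<^sub>R \<gamma> t + cos t *\<^sub>R \<gamma>' t"
  have "(?h has_vector_derivative 0) (at t within {0..d})" if t: "t \<in> {0..d}" for t
  proof -
    have "(?h has_vector_derivative (cos t *\<^sub>R \<gamma>' t + (- sin t) *\<^sub>R \<gamma> t - (sin t *\<^sub>R \<gamma>'' t + cos t *\<^sub>R \<gamma>' t)))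
        (at t within {0..d})"
      by (intro has_vector_derivative_diff has_vector_derivative_scaleR g(2,3) t)
         (auto intro!: derivative_eq_intros)
    then show ?thesis using ode[OF t] by simp
  qed
  from has_vector_derivative_zero_constant[OF convex_real_interval(5) this]
  obtain a where a: "\<And>t. t \<in> {0..d} \<Longrightarrow> ?h t = a" by blast
  have "(?k has_vector_derivative 0) (at t within {0..d})" if t: "t \<in> {0..d}" for t
  proof -
    have "(?k has_vector_derivative (sin t *\<^sub>R \<gamma>' t + cos t *\<^sub>R \<gamma> t + (cos t *\<^sub>R \<gamma>'' t + (- sin t) *\<^sub>R \<gamma>' t)))
        (at t within {0..d})"
      by (intro has_vector_derivative_add has_vector_derivative_scaleR g(2,3) t)
         (auto intro!: derivative_eq_intros)
    then show ?thesis using ode[OF t] by simp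
  qed
  from has_vector_derivative_zero_constant[OF convex_real_interval(5) this]
  obtain b where b: "\<And>t. t \<in> {0..d} \<Longrightarrow> ?k t = b" by blast
  \<comment> \<open>Evaluation at 0 identifies the constants, \<open>a\<close> with \<open>x\<close>
    and \<open>b\<close> with \<open>\<gamma>' 0\<close>; evaluation at \<open>d\<close> brings in
    \<open>y\<close>. Eliminating \<open>\<gamma>' d\<close> then leaves the initial velocity in
    terms of \<open>x\<close> and \<open>y\<close>.\<close>
  have h: "c *\<^sub>R y - sin d *\<^sub>R \<gamma>' d = x" and k: "sin d *\<^sub>R y + c *\<^sub>R \<gamma>' d = \<gamma>' 0"
    using a[of 0] a[of d] b[of 0] b[of d] d g0 cd by auto
  have "sin d *\<^sub>R \<gamma>' 0 = (sin d * sin d) *\<^sub>R y + c *\<^sub>R (sin d *\<^sub>R \<gamma>' d)"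
    by (simp add: scaleR_add_right mult.commute flip: k)
  also have "sin d *\<^sub>R \<gamma>' d = c *\<^sub>R y - x" using h by (simp add: algebra_simps)
  also have "(sin d * sin d) *\<^sub>R y + c *\<^sub>R (c *\<^sub>R y - x) = ((sin d)\<^sup>2 + (cos d)\<^sup>2) *\<^sub>R y - c *\<^sub>R x"
    by (simp add: cd algebra_simps power2_eq_square)
  finally have "sin d *\<^sub>R \<gamma>' 0 = y - c *\<^sub>R x" by simp
  then have "(1 / sin d) *\<^sub>R (sin d *\<^sub>R \<gamma>' 0) = (1 / sin d) *\<^sub>R (y - c *\<^sub>R x)" by (rule arg_cong)
  then have "\<gamma>' 0 = (1 / sin d) *\<^sub>R (y - c *\<^sub>R x)" using sd by simp
  moreover have "vector_derivative \<gamma> (at 0 within {0..d}) = \<gamma>' 0"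
    using d g(2)[of 0] by (intro vector_derivative_within_closed_interval) auto
  ultimately show ?thesis using sd' by (simp only: c_def d_def)
qed

text \<open>For \<open>y = x\<close> and \<open>y = - x\<close> the tangential component
  \<open>y - (x \<bullet> y) *\<^sub>R x\<close> is 0, so the formula agrees with the default value
  there. Being free of case distinctions, it serves both measurability and symmetry.\<close>

lemma influence_vector_eq:
  fixes x y :: "'a::euclidean_space"
  assumes x: "norm x = 1" and y: "norm y = 1"
  shows "influence_vector x y =
    (sphere_dist x y / sqrt (1 - (x \<bullet> y)\<^sup>2)) *\<^sub>R (y - (x \<bullet> y) *\<^sub>R x)"
proof (cases "y = x \<or> y = - x")
  case True
  then show ?thesis using x by (auto simp: influence_vector_def norm_eq_1)
next
  case False
  then have ne: "y \<noteq> x" "y \<noteq> - x" by auto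
  note someI_ex[OF unit_speed_minimizing_geodesic_exists[OF x y ne]]
  from unit_speed_minimizing_geodesic_initial_velocity[OF x y ne this] show ?thesis
    using ne by (simp add: influence_vector_def)
qed

text \<open>The tangential component of \<open>y\<close> has length
  \<open>sqrt (1 - (x \<bullet> y)\<^sup>2)\<close>, which cancels the denominator. At the antipode
  the vector is 0 while the distance is pi.\<close>

lemma influence_vector_norm:
  fixes x y :: "'a::euclidean_space"
  assumes x: "norm x = 1" and y: "norm y = 1" and ne: "y \<noteq> - x"
  shows "norm (influence_vector x y) = sphere_dist x y"
proof (cases "y = x")
  case True
  then show ?thesis by (simp add: influence_vector_def sphere_dist_def norm_eq_1[THEN iffD1, OF x])
next
  case False
  have c: "-1 < x \<bullet> y" "x \<bullet> y < 1"
    using unit_inner_bounds[OF x y] unit_inner_eq_1_iff[OF x y] unit_inner_eq_minus_1_iff[OF x y] ne False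
    unfolding less_le by metis+
  then have "\<bar>x \<bullet> y\<bar> < 1" by linarith
  then have pos: "0 < sqrt (1 - (x \<bullet> y)\<^sup>2)" by (simp only: abs_square_less_1[symmetric]) simp
  have n: "norm (y - (x \<bullet> y) *\<^sub>R x) = sqrt (1 - (x \<bullet> y)\<^sup>2)"
    by (rule real_sqrt_unique[symmetric]) (simp_all only: norm_unit_component_sq[OF x y] norm_ge_zero)
  have d: "sphere_dist x y \<ge> 0" using c by (simp add: sphere_dist_def arccos_lbound)
  have "norm (influence_vector x y) =
      \<bar>sphere_dist x y / sqrt (1 - (x \<bullet> y)\<^sup>2)\<bar> * sqrt (1 - (x \<bullet> y)\<^sup>2)"
    unfolding influence_vector_eq[OF x y] norm_scaleR n ..
  also have "\<dots> = sphere_dist x y" using d pos by simp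
  finally show ?thesis .
qed

text \<open>For a unit vector \<open>x\<close> this fixes the line through \<open>x\<close> and
  negates its orthogonal complement: it is minus the Householder reflection with normal
  \<open>x\<close>.\<close>

definition axis_reflection :: "'a::euclidean_space \<Rightarrow> 'a \<Rightarrow> 'a" where
  "axis_reflection x y = (2 * (x \<bullet> y)) *\<^sub>R x - y"

lemma inner_axis_reflection: "norm x = 1 \<Longrightarrow> x \<bullet> axis_reflection x y = x \<bullet> y"
  by (simp add: axis_reflection_def inner_diff norm_eq_1)

lemma orthogonal_transformation_axis_reflection:
  assumes "norm x = 1"
  shows "orthogonal_transformation (axis_reflection x)"
  unfolding orthogonal_transformation_def
proof
  show "linear (axis_reflection x)"
    by (intro linearI) (auto simp: axis_reflection_def inner_add algebra_simps)
  show "\<forall>v w. axis_reflection x v \<bullet> axis_reflection x w = v \<bullet> w"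
    using assms by (auto simp: axis_reflection_def inner_diff norm_eq_1 inner_commute algebra_simps)
qed

lemma norm_axis_reflection: "norm x = 1 \<Longrightarrow> norm (axis_reflection x y) = norm y"
  using orthogonal_transformation_axis_reflection orthogonal_transformation_norm by blast

text \<open>In the closed formula only the tangential component of \<open>y\<close> changes, and it
  changes sign; distance and denominator depend on \<open>x \<bullet> y\<close> alone.\<close>

lemma influence_vector_axis_reflection:
  assumes x: "norm x = 1" and y: "norm y = 1"
  shows "influence_vector x (axis_reflection x y) = - influence_vector x y"
proof -
  have y': "norm (axis_reflection x y) = 1" using x y by (simp only: norm_axis_reflection)
  have "axis_reflection x y - (x \<bullet> y) *\<^sub>R x = - (y - (x \<bullet> y) *\<^sub>R x)"
    unfolding axis_reflection_def mult_2 scaleR_add_left by simp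
  then show ?thesis
    unfolding influence_vector_eq[OF x y'] influence_vector_eq[OF x y] sphere_dist_def
      inner_axis_reflection[OF x]
    by (simp only: scaleR_minus_right)
qed

subsection \<open>Invariance of the uniform measure on the sphere\<close>

lemma nn_integral_lborel_translation:
  fixes g :: "'a::euclidean_space \<Rightarrow> ennreal"
  assumes [measurable]: "g \<in> borel_measurable borel"
  shows "(\<integral>\<^sup>+x. g (c + x) \<partial>lborel) = (\<integral>\<^sup>+x. g x \<partial>lborel)"
proof -
  have "(\<integral>\<^sup>+x. g x \<partial>lborel) = (\<integral>\<^sup>+x. g x \<partial>distr lborel borel ((+) c))"
    by (simp add: lborel_distr_plus)
  also have "\<dots> = (\<integral>\<^sup>+x. g (c + x) \<partial>lborel)"
    by (subst nn_integral_distr) auto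
  finally show ?thesis by simp
qed

text \<open>
  Haar-measure argument: a convolution with the indicator of the unit ball, which \<open>f\<close> preserves,
  is evaluated by Fubini in two ways.
\<close>
lemma nn_integral_lborel_orthogonal_transformation:
  fixes f :: "'a::euclidean_space \<Rightarrow> 'a" and g :: "'a \<Rightarrow> ennreal"
  assumes f: "orthogonal_transformation f" and g[measurable]: "g \<in> borel_measurable borel"
  shows "(\<integral>\<^sup>+x. g (f x) \<partial>lborel) = (\<integral>\<^sup>+x. g x \<partial>lborel)"
proof -
  define h :: "'a \<Rightarrow> ennreal" where "h = indicator (ball 0 1)"
  define V where "V = emeasure lborel (ball (0::'a) 1)"
  define k where "k = inv f"
  have lin: "linear f" and linv: "linear k" and surj: "surj f"
    using f orthogonal_transformation_inv[OF f]
    by (auto simp: k_def orthogonal_transformation_linear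
        orthogonal_transformation_surj)
  have fk: "f (k x) = x" for x unfolding k_def by (rule surj_f_inv_f[OF surj])
  have nf: "norm (f x) = norm x" for x using f by (simp add: orthogonal_transformation_norm)
  have [measurable]: "f \<in> borel_measurable borel" "k \<in> borel_measurable borel"
    using linear_continuous_on[OF linear_conv_bounded_linear[THEN iffD1, OF lin]]
      linear_continuous_on[OF linear_conv_bounded_linear[THEN iffD1, OF linv]]
    by (auto intro: borel_measurable_continuous_onI)
  have [measurable]: "h \<in> borel_measurable borel" unfolding h_def by (intro borel_measurable_indicator borel_open open_ball)
  have h_norm: "h x = h y" if "norm x = norm y" for x y using that by (simp add: h_def indicator_def)
  have hV: "(\<integral>\<^sup>+x. h x \<partial>lborel) = V" by (simp add: h_def V_def)
  have V: "V \<noteq> 0" "V \<noteq> \<infinity>"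
  proof -
    show "V \<noteq> \<infinity>" using emeasure_lborel_ball_finite[of "0::'a" 1] by (simp add: V_def)
    show "V \<noteq> 0"
      using content_ball_pos[of 1 "0::'a"] by (auto simp: V_def measure_def)
  qed
  have "(\<integral>\<^sup>+x. g x \<partial>lborel) * V = (\<integral>\<^sup>+y. (\<integral>\<^sup>+x. g x \<partial>lborel) * h y \<partial>lborel)"
    by (simp add: nn_integral_cmult hV)
  \<comment> \<open>For fixed \<open>y\<close>, shifting \<open>x\<close> by \<open>f y\<close>
    leaves the inner integral unchanged; this is how \<open>f\<close> enters.\<close>
  also have "\<dots> = (\<integral>\<^sup>+y. (\<integral>\<^sup>+x. g (f y + x) * h y \<partial>lborel) \<partial>lborel)"
    by (simp add: nn_integral_multc nn_integral_lborel_translation)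
  also have "\<dots> = (\<integral>\<^sup>+x. (\<integral>\<^sup>+y. g (f y + x) * h y \<partial>lborel) \<partial>lborel)"
    by (rule lborel_pair.Fubini') simp
  also have "\<dots> = (\<integral>\<^sup>+x. (\<integral>\<^sup>+y. g (f y) * h (f y - x) \<partial>lborel) \<partial>lborel)"
  proof (rule nn_integral_cong)
    fix x
    \<comment> \<open>Shift \<open>y\<close> by \<open>- k x\<close>. Since \<open>f\<close> inverts
      \<open>k\<close>, the argument of \<open>g\<close> becomes \<open>f y\<close>, and
      \<open>h\<close>, which sees only norms, can be evaluated at the image \<open>f y - x\<close>
      instead.\<close>
    have "(\<integral>\<^sup>+y. g (f y + x) * h y \<partial>lborel) = (\<integral>\<^sup>+y. g (f (- k x + y) + x) * h (- k x + y) \<partial>lborel)"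
      by (rule nn_integral_lborel_translation[symmetric, of "\<lambda>y. g (f y + x) * h y"]) simp
    also have "\<dots> = (\<integral>\<^sup>+y. g (f y) * h (f y - x) \<partial>lborel)"
    proof (rule nn_integral_cong)
      fix y
      have "f (- k x + y) = f y - x" using lin by (simp add: linear_diff fk)
      moreover from this have "norm (- k x + y) = norm (f y - x)" by (metis nf)
      from h_norm[OF this] have "h (- k x + y) = h (f y - x)" .
      ultimately show "g (f (- k x + y) + x) * h (- k x + y) = g (f y) * h (f y - x)" by simp
    qed
    finally show "(\<integral>\<^sup>+y. g (f y + x) * h y \<partial>lborel) = (\<integral>\<^sup>+y. g (f y) * h (f y - x) \<partial>lborel)" .
  qed
  also have "\<dots> = (\<integral>\<^sup>+y. (\<integral>\<^sup>+x. g (f y) * h (f y - x) \<partial>lborel) \<partial>lborel)"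
    by (rule lborel_pair.Fubini') simp
  also have "\<dots> = (\<integral>\<^sup>+y. g (f y) * V \<partial>lborel)"
  proof (rule nn_integral_cong)
    fix y
    have "h (f y - x) = h (- f y + x)" for x by (rule h_norm) (simp add: norm_minus_commute)
    then show "(\<integral>\<^sup>+x. g (f y) * h (f y - x) \<partial>lborel) = g (f y) * V"
      using nn_integral_lborel_translation[of h "- f y"] by (simp add: nn_integral_cmult hV)
  qed
  also have "\<dots> = (\<integral>\<^sup>+y. g (f y) \<partial>lborel) * V" by (simp add: nn_integral_multc)
  finally show ?thesis using V by (metis ennreal_mult_cancel_left infinity_ennreal_def mult.commute)
qed

section \<open>Integration against the cone measure\<close>

lemma sets_uniform_sphere:
  "sets (uniform_sphere :: 'a::euclidean_space measure) = sets (restrict_space borel (sphere 0 1))"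
  unfolding uniform_sphere_def by (intro sets_restrict_space_cong) simp

lemma space_uniform_sphere: "space (uniform_sphere :: 'a::euclidean_space measure) = sphere 0 1"
  by (simp add: uniform_sphere_def space_restrict_space)

text \<open>Unfolds the radial projection into a Lebesgue integral over the ball. The indicator of
  the sphere discards the origin, where \<open>sgn\<close> is 0.\<close>

lemma nn_integral_uniform_sphere:
  fixes g :: "'a::euclidean_space \<Rightarrow> ennreal"
  assumes g: "g \<in> borel_measurable uniform_sphere"
  shows "(\<integral>\<^sup>+x. g x \<partial>uniform_sphere) =
    (\<integral>\<^sup>+x. g (sgn x) * indicator (sphere 0 1) (sgn x) * indicator (ball 0 1) x \<partial>lborel)
      / emeasure lborel (ball (0::'a) 1)"
proof -
  let ?U = "uniform_measure lborel (ball (0::'a) 1)"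
  have "g \<in> borel_measurable (restrict_space borel (sphere 0 1))"
    using g by (simp add: measurable_cong_sets[OF sets_uniform_sphere refl])
  then have [measurable]: "(\<lambda>x. g x * indicator (sphere 0 1) x) \<in> borel_measurable borel"
    by (subst (asm) borel_measurable_restrict_space_iff_ennreal) auto
  have "(\<integral>\<^sup>+x. g x \<partial>uniform_sphere) = (\<integral>\<^sup>+x. g x * indicator (sphere 0 1) x \<partial>distr ?U borel sgn)"
    unfolding uniform_sphere_def by (subst nn_integral_restrict_space) auto
  also have "\<dots> = (\<integral>\<^sup>+x. g (sgn x) * indicator (sphere 0 1) (sgn x) \<partial>?U)"
    by (subst nn_integral_distr) auto
  also have "\<dots> = (\<integral>\<^sup>+x. g (sgn x) * indicator (sphere 0 1) (sgn x) * indicator (ball 0 1) x \<partial>lborel)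
      / emeasure lborel (ball (0::'a) 1)"
  proof (rule nn_integral_uniform_measure)
    show "(\<lambda>x. g (sgn x) * indicator (sphere 0 1) (sgn x)) \<in> borel_measurable lborel"
      using measurable_compose[of sgn lborel borel "\<lambda>x. g x * indicator (sphere 0 1) x" borel] by simp
  qed simp
  finally show ?thesis .
qed

text \<open>An orthogonal map commutes with \<open>sgn\<close> and preserves sphere and ball, so the
  invariance descends from Lebesgue measure.\<close>

lemma nn_integral_uniform_sphere_orthogonal_transformation:
  fixes f :: "'a::euclidean_space \<Rightarrow> 'a" and g :: "'a \<Rightarrow> ennreal"
  assumes f: "orthogonal_transformation f" and g: "g \<in> borel_measurable uniform_sphere"
  shows "(\<integral>\<^sup>+x. g (f x) \<partial>uniform_sphere) = (\<integral>\<^sup>+x. g x \<partial>uniform_sphere)"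
proof -
  have lin: "linear f" by (rule orthogonal_transformation_linear[OF f])
  have nf: "norm (f x) = norm x" for x using f by (simp add: orthogonal_transformation_norm)
  have fs: "f (sgn x) = sgn (f x)" for x
    using linear_scale[OF lin] by (simp add: sgn_div_norm nf)
  have fb: "f \<in> borel_measurable borel"
    using linear_continuous_on[OF linear_conv_bounded_linear[THEN iffD1, OF lin]]
    by (auto intro: borel_measurable_continuous_onI)
  have "f \<in> uniform_sphere \<rightarrow>\<^sub>M uniform_sphere"
    unfolding measurable_cong_sets[OF sets_uniform_sphere sets_uniform_sphere]
    using fb nf by (intro measurable_restrict_space3) auto
  then have gf: "(\<lambda>x. g (f x)) \<in> borel_measurable uniform_sphere"
    using g by (rule measurable_compose)
  have "g \<in> borel_measurable (restrict_space borel (sphere 0 1))"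
    using g by (simp add: measurable_cong_sets[OF sets_uniform_sphere refl])
  then have G: "(\<lambda>x. g x * indicator (sphere 0 1) x) \<in> borel_measurable borel"
    by (subst (asm) borel_measurable_restrict_space_iff_ennreal) auto
  have [measurable]: "ball (0::'a) 1 \<in> sets borel" by (intro borel_open open_ball)
  have [measurable]: "(\<lambda>x. g (sgn x) * indicator (sphere 0 1) (sgn x) * indicator (ball 0 1) x)
      \<in> borel_measurable borel"
    using measurable_compose[OF borel_measurable_sgn G] by measurable
  have ind: "indicator (sphere 0 1) (f x) = (indicator (sphere 0 1) x :: ennreal)"
    "indicator (ball 0 1) (f x) = (indicator (ball 0 1) x :: ennreal)" for x
    by (auto simp: indicator_def nf)
  have "(\<integral>\<^sup>+x. g (f (sgn x)) * indicator (sphere 0 1) (sgn x) * indicator (ball 0 1) x \<partial>lborel)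
      = (\<integral>\<^sup>+x. g (sgn (f x)) * indicator (sphere 0 1) (sgn (f x)) * indicator (ball 0 1) (f x) \<partial>lborel)"
    by (simp only: fs[symmetric] ind)
  also have "\<dots> = (\<integral>\<^sup>+x. g (sgn x) * indicator (sphere 0 1) (sgn x) * indicator (ball 0 1) x \<partial>lborel)"
    by (rule nn_integral_lborel_orthogonal_transformation[OF f,
          of "\<lambda>x. g (sgn x) * indicator (sphere 0 1) (sgn x) * indicator (ball 0 1) x"]) simp
  finally show ?thesis
    by (simp only: nn_integral_uniform_sphere[OF g] nn_integral_uniform_sphere[OF gf])
qed

text \<open>The total mass is 1, as only the null set \<open>{0}\<close> is projected off the
  sphere. Finiteness supplies the sigma-finiteness needed for products and Tonelli.\<close>

lemma finite_measure_uniform_sphere: "finite_measure (uniform_sphere :: 'a::euclidean_space measure)"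
proof (rule finite_measureI)
  have AE: "AE x in lborel. x \<noteq> (0::'a)" by (rule AE_lborel_singleton)
  have "emeasure (uniform_sphere :: 'a measure) (space uniform_sphere) = (\<integral>\<^sup>+x. 1 \<partial>(uniform_sphere :: 'a measure))"
    by simp
  also have "\<dots> = (\<integral>\<^sup>+x. 1 * indicator (sphere (0::'a) 1) (sgn x) * indicator (ball 0 1) x \<partial>lborel)
      / emeasure lborel (ball (0::'a) 1)"
    by (rule nn_integral_uniform_sphere[of "\<lambda>_. 1"]) simp
  also have "(\<integral>\<^sup>+x. 1 * indicator (sphere (0::'a) 1) (sgn x) * indicator (ball 0 1) x \<partial>lborel)
     = (\<integral>\<^sup>+x. indicator (ball (0::'a) 1) x \<partial>lborel)"
    using AE by (intro nn_integral_cong_AE) (auto simp: norm_sgn)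
  also have "\<dots> = emeasure lborel (ball (0::'a) 1)" by simp
  also have "\<dots> / \<dots> = 1"
    using content_ball_pos[of 1 "0::'a"] emeasure_lborel_ball_finite[of "0::'a" 1]
    by (intro ennreal_divide_self) (auto simp: measure_def)
  finally show "emeasure (uniform_sphere :: 'a measure) (space uniform_sphere) \<noteq> \<infinity>" by simp
qed

text \<open>All points that \<open>sgn\<close> sends to \<open>x\<close> lie on the line
  \<open>span {x}\<close>, which is Lebesgue null from dimension 2 on. In dimension 1 the two points
  of the sphere are atoms.\<close>

lemma AE_uniform_sphere_neq:
  fixes x :: "'a::euclidean_space"
  assumes dim: "DIM('a) \<ge> 2" and x: "norm x = 1"
  shows "AE y in uniform_sphere. y \<noteq> x"
proof -
  have xs: "{x} \<in> sets uniform_sphere"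
    using x by (auto simp: sets_uniform_sphere sets_restrict_space_iff)
  have "negligible (span {x})"
    using dim by (intro negligible_lowdim) (simp add: dim_singleton x)
  then have "span {x} \<in> null_sets lborel"
    by (simp add: negligible_iff_null_sets null_sets_completion_iff borel_closed closed_span)
  then have "AE z in lborel. z \<notin> span {x}" by (rule AE_not_in)
  then have "AE z in lborel. sgn z \<noteq> x"
  proof eventually_elim
    case (elim z)
    have "norm z *\<^sub>R sgn z = z" by (cases "z = 0") (simp_all add: sgn_div_norm)
    then show ?case using elim by (metis insertI1 span_base span_scale)
  qed
  then have "(\<integral>\<^sup>+z. indicator {x} (sgn z) * indicator (sphere 0 1) (sgn z) * indicator (ball 0 1) z \<partial>lborel)
     = (\<integral>\<^sup>+z. 0 \<partial>(lborel :: 'a measure))"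
    by (intro nn_integral_cong_AE) auto
  then have "emeasure uniform_sphere {x} = 0"
    using nn_integral_uniform_sphere[of "indicator {x}"] xs by simp
  then have "{x} \<in> null_sets uniform_sphere" using xs by auto
  from AE_not_in[OF this] show ?thesis by simp
qed

subsection \<open>The product measure\<close>

lemma product_sigma_finite_uniform_sphere:
  "product_sigma_finite (\<lambda>_. uniform_sphere :: 'a::euclidean_space measure)"
  by (intro product_sigma_finite.intro finite_measure.axioms(1) finite_measure_uniform_sphere)

lemma norm_uniform_sphere_power:
  "X \<in> space (uniform_sphere_power N) \<Longrightarrow> i < N \<Longrightarrow> norm (X i) = 1"
  by (auto simp: uniform_sphere_power_def space_PiM space_uniform_sphere PiE_iff)

lemma measurable_uniform_sphere_power_component:
  "i < N \<Longrightarrow> (\<lambda>X. X i) \<in> uniform_sphere_power N \<rightarrow>\<^sub>M uniform_sphere"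
  unfolding uniform_sphere_power_def by (rule measurable_component_singleton) simp

lemma measurable_uniform_sphereD:
  "f \<in> M \<rightarrow>\<^sub>M (uniform_sphere :: 'a::euclidean_space measure) \<Longrightarrow> f \<in> borel_measurable M"
  by (subst (asm) measurable_cong_sets[OF refl sets_uniform_sphere])
     (simp add: measurable_restrict_space2_iff)

lemma borel_measurable_uniform_sphere_power_component [measurable]:
  "i < N \<Longrightarrow> (\<lambda>X. X i :: 'a::euclidean_space) \<in> borel_measurable (uniform_sphere_power N)"
  by (intro measurable_uniform_sphereD measurable_uniform_sphere_power_component)

text \<open>\<open>arccos\<close> is specified only on \<open>{-1..1}\<close>, so a version cut off
  by an indicator is used; inner products of unit vectors stay in that interval.\<close>

lemma borel_measurable_sphere_dist:
  fixes M :: "'b measure" and f g :: "'b \<Rightarrow> 'a::euclidean_space"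
  assumes [measurable]: "f \<in> borel_measurable M" "g \<in> borel_measurable M"
    and n: "\<And>x. x \<in> space M \<Longrightarrow> norm (f x) = 1" "\<And>x. x \<in> space M \<Longrightarrow> norm (g x) = 1"
  shows "(\<lambda>x. sphere_dist (f x) (g x)) \<in> borel_measurable M"
proof -
  have [measurable]: "(\<lambda>r. indicator {-1..1} r *\<^sub>R arccos r) \<in> borel_measurable borel"
    by (intro borel_measurable_continuous_on_indicator continuous_on_arccos') auto
  have "(\<lambda>x. indicator {-1..1} (f x \<bullet> g x) *\<^sub>R arccos (f x \<bullet> g x)) \<in> borel_measurable M"
    by measurable
  also have "?this \<longleftrightarrow> ?thesis"
  proof (rule measurable_cong)
    fix x assume "x \<in> space M"
    then have "f x \<bullet> g x \<in> {-1..1}" using n unit_inner_bounds[of "f x" "g x"] by simp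
    then show "indicator {-1..1} (f x \<bullet> g x) *\<^sub>R arccos (f x \<bullet> g x) = sphere_dist (f x) (g x)"
      by (simp add: sphere_dist_def)
  qed
  finally show ?thesis .
qed

lemma borel_measurable_sphere_dist_power:
  assumes "i < N" "j < N"
  shows "(\<lambda>X. sphere_dist (X i) (X j :: 'a::euclidean_space)) \<in> borel_measurable (uniform_sphere_power N)"
  using assms by (intro borel_measurable_sphere_dist) (auto simp: norm_uniform_sphere_power)

lemma borel_measurable_influence_vector_power:
  assumes [measurable]: "i < N" "j < N"
  shows "(\<lambda>X. influence_vector (X i) (X j :: 'a::euclidean_space)) \<in> borel_measurable (uniform_sphere_power N)"
proof -
  note [measurable] = borel_measurable_sphere_dist_power
  have "(\<lambda>X. (sphere_dist (X i) (X j) / sqrt (1 - (X i \<bullet> X j)\<^sup>2)) *\<^sub>R (X j - (X i \<bullet> X j) *\<^sub>R (X i :: 'a)))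
      \<in> borel_measurable (uniform_sphere_power N)"
    by measurable
  also have "?this \<longleftrightarrow> ?thesis"
    using assms by (intro measurable_cong) (simp add: influence_vector_eq norm_uniform_sphere_power)
  finally show ?thesis .
qed

text \<open>Tonelli with one point integrated first, so that facts about a single sphere apply while
  all other points are frozen.\<close>

lemma nn_integral_uniform_sphere_power_coordinate:
  fixes f :: "(nat \<Rightarrow> 'a::euclidean_space) \<Rightarrow> ennreal"
  assumes k: "k < N" and f: "f \<in> borel_measurable (uniform_sphere_power N)"
  shows "(\<integral>\<^sup>+X. f X \<partial>uniform_sphere_power N) =
    (\<integral>\<^sup>+X. (\<integral>\<^sup>+y. f (X(k := y)) \<partial>uniform_sphere) \<partial>PiM ({..<N} - {k}) (\<lambda>_. uniform_sphere))"
proof -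
  have "insert k ({..<N} - {k}) = {..<N}" using k by auto
  then show ?thesis
    using product_sigma_finite.product_nn_integral_insert[OF product_sigma_finite_uniform_sphere,
        of "{..<N} - {k}" k f] f
    by (simp add: uniform_sphere_power_def)
qed

lemma fun_upd_uniform_sphere_power:
  assumes "k < N" "X \<in> space (PiM ({..<N} - {k}) (\<lambda>_. uniform_sphere))"
    "y \<in> space (uniform_sphere :: 'a::euclidean_space measure)"
  shows "X(k := y) \<in> space (uniform_sphere_power N)"
  using assms by (auto simp: uniform_sphere_power_def space_PiM PiE_iff extensional_def)

lemma measurable_fun_upd_uniform_sphere_power:
  assumes "k < N" "X \<in> space (PiM ({..<N} - {k}) (\<lambda>_. uniform_sphere :: 'a::euclidean_space measure))"
  shows "(\<lambda>y. X(k := y)) \<in> uniform_sphere \<rightarrow>\<^sub>M uniform_sphere_power N"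
proof -
  have "insert k ({..<N} - {k}) = {..<N}" using assms by auto
  then show ?thesis
    using measurable_fun_upd[where I="{..<N}" and J="{..<N} - {k}" and i=k and M="\<lambda>_. uniform_sphere"
       and N=uniform_sphere and f="\<lambda>_. X" and h="\<lambda>y. y"] assms
    by (simp add: uniform_sphere_power_def)
qed

definition reflect_coordinate :: "nat \<Rightarrow> nat \<Rightarrow> (nat \<Rightarrow> 'a::euclidean_space) \<Rightarrow> nat \<Rightarrow> 'a" where
  "reflect_coordinate i k X = X(k := axis_reflection (X i) (X k))"

lemma measurable_reflect_coordinate:
  assumes i: "i < N" and k: "k < N"
  shows "(reflect_coordinate i k :: (nat \<Rightarrow> 'a::euclidean_space) \<Rightarrow> _)
    \<in> uniform_sphere_power N \<rightarrow>\<^sub>M uniform_sphere_power N"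
proof -
  have [measurable]: "(\<lambda>X. axis_reflection (X i) (X k :: 'a)) \<in> borel_measurable (uniform_sphere_power N)"
    unfolding axis_reflection_def using i k by measurable
  have "(\<lambda>X. axis_reflection (X i) (X k :: 'a)) \<in> uniform_sphere_power N \<rightarrow>\<^sub>M uniform_sphere"
    unfolding measurable_cong_sets[OF refl sets_uniform_sphere]
    using i k by (auto simp: measurable_restrict_space2_iff norm_axis_reflection norm_uniform_sphere_power)
  moreover have "(\<lambda>X. X) \<in> uniform_sphere_power N \<rightarrow>\<^sub>M PiM {..<N} (\<lambda>_. uniform_sphere)"
    by (simp add: uniform_sphere_power_def)
  ultimately show ?thesis
    unfolding uniform_sphere_power_def reflect_coordinate_def
    using k by (intro measurable_PiM_single') (auto simp: space_PiM PiE_iff extensional_def space_uniform_sphere i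
      norm_axis_reflection)
qed

text \<open>The axis depends on the configuration, but only through point \<open>i\<close>. As
  \<open>i \<noteq> k\<close>, it is frozen during the integration over point \<open>k\<close>,
  where the map is one fixed orthogonal transformation.\<close>

lemma distr_reflect_coordinate:
  assumes i: "i < N" and k: "k < N" and ne: "i \<noteq> k"
  shows "distr (uniform_sphere_power N) (uniform_sphere_power N)
      (reflect_coordinate i k :: (nat \<Rightarrow> 'a::euclidean_space) \<Rightarrow> _) = uniform_sphere_power N"
proof (rule measure_eqI)
  let ?P = "uniform_sphere_power N :: (nat \<Rightarrow> 'a) measure"
  note T = measurable_reflect_coordinate[OF i k, where 'a='a]
  fix A assume "A \<in> sets (distr ?P ?P (reflect_coordinate i k))"
  then have A[measurable]: "A \<in> sets ?P" by simp
  have "emeasure (distr ?P ?P (reflect_coordinate i k)) A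
      = (\<integral>\<^sup>+X. indicator A X \<partial>distr ?P ?P (reflect_coordinate i k))"
    using A by simp
  also have "\<dots> = (\<integral>\<^sup>+X. indicator A (reflect_coordinate i k X) \<partial>?P)"
    by (rule nn_integral_distr[OF T]) simp
  also have "\<dots> = (\<integral>\<^sup>+X. (\<integral>\<^sup>+y. indicator A (reflect_coordinate i k (X(k := y))) \<partial>uniform_sphere)
      \<partial>PiM ({..<N} - {k}) (\<lambda>_. uniform_sphere))"
    using T by (intro nn_integral_uniform_sphere_power_coordinate k) simp
  also have "\<dots> = (\<integral>\<^sup>+X. (\<integral>\<^sup>+y. indicator A (X(k := y)) \<partial>uniform_sphere)
      \<partial>PiM ({..<N} - {k}) (\<lambda>_. uniform_sphere))"
  proof (rule nn_integral_cong)
    fix X :: "nat \<Rightarrow> 'a" assume X: "X \<in> space (PiM ({..<N} - {k}) (\<lambda>_. uniform_sphere))"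
    have "norm (X i) = 1" using X i ne by (auto simp: space_PiM PiE_iff space_uniform_sphere)
    then have f: "orthogonal_transformation (axis_reflection (X i))"
      by (rule orthogonal_transformation_axis_reflection)
    have "(\<lambda>y. indicator A (X(k := y)) :: ennreal) \<in> borel_measurable uniform_sphere"
      using measurable_fun_upd_uniform_sphere_power[OF k X] by simp
    from nn_integral_uniform_sphere_orthogonal_transformation[OF f this]
    show "(\<integral>\<^sup>+y. indicator A (reflect_coordinate i k (X(k := y))) \<partial>uniform_sphere)
        = (\<integral>\<^sup>+y. indicator A (X(k := y)) \<partial>uniform_sphere)"
      using ne by (simp add: reflect_coordinate_def)
  qed
  also have "\<dots> = (\<integral>\<^sup>+X. indicator A X \<partial>?P)"
    by (intro nn_integral_uniform_sphere_power_coordinate[symmetric] k) simp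
  also have "\<dots> = emeasure ?P A" by simp
  finally show "emeasure (distr ?P ?P (reflect_coordinate i k)) A = emeasure ?P A" .
qed simp

lemma integral_eq_0_if_odd_reflect_coordinate:
  fixes F :: "(nat \<Rightarrow> 'a::euclidean_space) \<Rightarrow> real"
  assumes ik: "i < N" "k < N" "i \<noteq> k"
    and F: "F \<in> borel_measurable (uniform_sphere_power N)"
    and odd: "\<And>X. X \<in> space (uniform_sphere_power N) \<Longrightarrow> F (reflect_coordinate i k X) = - F X"
  shows "(\<integral>X. F X \<partial>uniform_sphere_power N) = 0"
proof -
  let ?P = "uniform_sphere_power N :: (nat \<Rightarrow> 'a) measure"
  have "(\<integral>X. F X \<partial>?P) = (\<integral>X. F X \<partial>distr ?P ?P (reflect_coordinate i k))"
    by (simp add: distr_reflect_coordinate[OF ik])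
  also have "\<dots> = (\<integral>X. F (reflect_coordinate i k X) \<partial>?P)"
    by (rule integral_distr[OF measurable_reflect_coordinate[OF ik(1,2)] F])
  also have "\<dots> = (\<integral>X. - F X \<partial>?P)"
    by (rule Bochner_Integration.integral_cong[OF refl odd])
  finally show ?thesis by simp
qed

text \<open>With every point but \<open>j\<close> frozen, the exceptional set is the single point
  \<open>- X i\<close>.\<close>

lemma AE_uniform_sphere_power_not_antipodal:
  assumes dim: "DIM('a::euclidean_space) \<ge> 2" and ij: "i < N" "j < N" "i \<noteq> j"
  shows "AE X in uniform_sphere_power N. X j \<noteq> - (X i :: 'a)"
proof -
  let ?P = "uniform_sphere_power N :: (nat \<Rightarrow> 'a) measure"
  have [measurable]: "Measurable.pred ?P (\<lambda>X. X j = - X i)"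
  proof -
    have [measurable]: "(\<lambda>X. X j + X i) \<in> borel_measurable ?P" using ij by measurable
    have "Measurable.pred ?P (\<lambda>X. X j + X i \<in> {0})" by measurable
    then show ?thesis by (simp add: eq_neg_iff_add_eq_0)
  qed
  define f :: "(nat \<Rightarrow> 'a) \<Rightarrow> ennreal" where "f X = (if X j = - X i then 1 else 0)" for X
  have f[measurable]: "f \<in> borel_measurable ?P" unfolding f_def by measurable
  have "(\<integral>\<^sup>+X. f X \<partial>?P) =
      (\<integral>\<^sup>+X. (\<integral>\<^sup>+y. f (X(j := y)) \<partial>uniform_sphere) \<partial>PiM ({..<N} - {j}) (\<lambda>_. uniform_sphere))"
    by (rule nn_integral_uniform_sphere_power_coordinate[OF ij(2) f])
  also have "\<dots> = (\<integral>\<^sup>+X. 0 \<partial>PiM ({..<N} - {j}) (\<lambda>_. uniform_sphere :: 'a measure))"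
  proof (rule nn_integral_cong)
    fix X :: "nat \<Rightarrow> 'a" assume X: "X \<in> space (PiM ({..<N} - {j}) (\<lambda>_. uniform_sphere))"
    have "norm (- X i) = 1" using X ij by (auto simp: space_PiM PiE_iff space_uniform_sphere)
    from AE_uniform_sphere_neq[OF dim this]
    have "(\<integral>\<^sup>+y. f (X(j := y)) \<partial>uniform_sphere) = (\<integral>\<^sup>+y. 0 \<partial>(uniform_sphere :: 'a measure))"
      using ij by (intro nn_integral_cong_AE) (auto simp: f_def elim!: eventually_mono)
    then show "(\<integral>\<^sup>+y. f (X(j := y)) \<partial>uniform_sphere) = 0" by simp
  qed
  finally have "(\<integral>\<^sup>+X. f X \<partial>?P) = 0" by simp
  then have "AE X in ?P. f X = 0"
    by (subst (asm) nn_integral_0_iff_AE) simp_all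
  then show ?thesis by eventually_elim (auto simp: f_def split: if_splits)
qed

subsection \<open>The pair distance measure\<close>

lemma sphere_dist_nonneg:
  fixes x y :: "'a::euclidean_space"
  assumes "norm x = 1" "norm y = 1"
  shows "0 \<le> sphere_dist x y"
  using unit_inner_bounds[OF assms] by (simp add: sphere_dist_def arccos_lbound)

lemma sphere_dist_self: "norm x = 1 \<Longrightarrow> sphere_dist x x = 0"
  by (simp add: sphere_dist_def norm_eq_1)

lemma influence_vector_norm_le:
  fixes x y :: "'a::euclidean_space"
  assumes "norm x = 1" "norm y = 1"
  shows "norm (influence_vector x y) \<le> sphere_dist x y"
proof (cases "y = - x")
  case True
  then show ?thesis using sphere_dist_nonneg[OF assms] by (simp add: influence_vector_def)
qed (simp add: influence_vector_norm assms)

lemma sphere_dist_axis_reflection: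
  "norm x = 1 \<Longrightarrow> sphere_dist x (axis_reflection x y) = sphere_dist x y"
  by (simp add: sphere_dist_def inner_axis_reflection)

definition ordered_pairs :: "nat \<Rightarrow> (nat \<times> nat) set" where
  "ordered_pairs N = {(i, j). i < N \<and> j < N \<and> i \<noteq> j}"

lemma finite_ordered_pairs: "finite (ordered_pairs N)"
  by (rule finite_subset[of _ "{..<N} \<times> {..<N}"]) (auto simp: ordered_pairs_def)

lemma sum_ordered_pairs:
  fixes f :: "nat \<Rightarrow> nat \<Rightarrow> 'b::comm_monoid_add"
  shows "(\<Sum>(i, j)\<in>ordered_pairs N. f i j) = (\<Sum>i<N. \<Sum>j<N. if i = j then 0 else f i j)"
proof -
  have "(\<Sum>i<N. \<Sum>j<N. if i = j then 0 else f i j)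
      = (\<Sum>(i, j)\<in>{..<N} \<times> {..<N}. if i = j then 0 else f i j)"
    by (rule sum.cartesian_product)
  also have "\<dots> = (\<Sum>(i, j)\<in>ordered_pairs N. f i j)"
    by (rule sum.mono_neutral_cong_right) (auto simp: ordered_pairs_def)
  finally show ?thesis by simp
qed

text \<open>
  The set function in the definition of \<open>\<rho>\<close> is the push-forward under \<open>((i, j), X) \<mapsto> d(x\<^sub>i, x\<^sub>j)\<close> of a
  measure on pairs times configurations, hence a measure.
\<close>
lemma nn_integral_pair_distance_measure:
  fixes N :: nat and \<mu> :: "(nat \<Rightarrow> 'a::euclidean_space) measure" and g :: "real \<Rightarrow> ennreal"
  defines "\<mu> \<equiv> uniform_sphere_power N"
  assumes g: "g \<in> borel_measurable (restrict_space borel {0..})"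
  shows "(\<integral>\<^sup>+r. g r \<partial>pair_distance_measure N \<mu>) =
    ennreal (1 / (real N * (real N - 1))) *
      (\<Sum>(i, j)\<in>ordered_pairs N.
        \<integral>\<^sup>+X. ennreal ((sphere_dist (X i) (X j))\<^sup>2) * g (sphere_dist (X i) (X j)) \<partial>\<mu>)"
proof -
  define c where "c = ennreal (1 / (real N * (real N - 1)))"
  define B where "B = restrict_space borel {0::real..}"
  define K where "K = count_space (ordered_pairs N) \<Otimes>\<^sub>M \<mu>"
  define D where "D = (\<lambda>(p, X :: nat \<Rightarrow> 'a). sphere_dist (X (fst p)) (X (snd p)))"
  \<comment> \<open>The weight \<open>c * (D z)\<^sup>2\<close> carries the normalisation and the
    squared distance from the definition of \<open>\<rho>\<close>; counting measure on the pairs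
    produces the sum.\<close>
  define M where "M = distr (density K (\<lambda>z. c * ennreal ((D z)\<^sup>2))) B D"
  have D_pair: "(\<lambda>X. D (p, X)) \<in> borel_measurable \<mu>" if "p \<in> ordered_pairs N" for p
    using that unfolding D_def \<mu>_def ordered_pairs_def
    by (auto intro!: borel_measurable_sphere_dist_power)
  have D[measurable]: "D \<in> borel_measurable K"
    unfolding K_def
    by (rule measurable_pair_measure_countable1[OF countable_finite[OF finite_ordered_pairs] D_pair])
  have "0 \<le> D z" if "z \<in> space K" for z
    using that by (auto simp: K_def D_def space_pair_measure ordered_pairs_def \<mu>_def
        intro!: sphere_dist_nonneg norm_uniform_sphere_power)
  then have DB[measurable]: "D \<in> K \<rightarrow>\<^sub>M B"
    unfolding B_def by (simp add: measurable_restrict_space2_iff)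
  interpret \<mu>: sigma_finite_measure \<mu>
    unfolding \<mu>_def uniform_sphere_power_def
    by (rule product_sigma_finite.sigma_finite[OF product_sigma_finite_uniform_sphere]) simp
  have *: "(\<integral>\<^sup>+r. h r \<partial>M) = c * (\<Sum>(i, j)\<in>ordered_pairs N.
        \<integral>\<^sup>+X. ennreal ((sphere_dist (X i) (X j))\<^sup>2) * h (sphere_dist (X i) (X j)) \<partial>\<mu>)"
    if h[measurable]: "h \<in> borel_measurable B" for h
  proof -
    have hD[measurable]: "(\<lambda>z. h (D z)) \<in> borel_measurable K" using DB h by (rule measurable_compose)
    have hD_pair: "(\<lambda>X. h (D (p, X))) \<in> borel_measurable \<mu>" if "p \<in> ordered_pairs N" for p
    proof -
      have "(\<lambda>X. (p, X)) \<in> \<mu> \<rightarrow>\<^sub>M K" unfolding K_def using that by (intro measurable_Pair1') simp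
      then show ?thesis using hD by (rule measurable_compose)
    qed
    have "(\<integral>\<^sup>+r. h r \<partial>M) = (\<integral>\<^sup>+z. h (D z) \<partial>density K (\<lambda>z. c * ennreal ((D z)\<^sup>2)))"
      unfolding M_def by (rule nn_integral_distr) simp_all
    also have "\<dots> = (\<integral>\<^sup>+z. c * ennreal ((D z)\<^sup>2) * h (D z) \<partial>K)"
      by (rule nn_integral_density) measurable
    also have "\<dots> = (\<integral>\<^sup>+p. (\<integral>\<^sup>+X. c * ennreal ((D (p, X))\<^sup>2) * h (D (p, X)) \<partial>\<mu>) \<partial>count_space (ordered_pairs N))"
      unfolding K_def by (rule \<mu>.nn_integral_fst[symmetric]) (simp add: K_def[symmetric])
    also have "\<dots> = (\<Sum>p\<in>ordered_pairs N. \<integral>\<^sup>+X. c * ennreal ((D (p, X))\<^sup>2) * h (D (p, X)) \<partial>\<mu>)"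
      by (rule nn_integral_count_space_finite[OF finite_ordered_pairs])
    also have "\<dots> = (\<Sum>p\<in>ordered_pairs N. c * (\<integral>\<^sup>+X. ennreal ((D (p, X))\<^sup>2) * h (D (p, X)) \<partial>\<mu>))"
    proof (rule sum.cong[OF refl])
      fix p assume p: "p \<in> ordered_pairs N"
      note [measurable] = D_pair[OF p] hD_pair[OF p]
      show "(\<integral>\<^sup>+X. c * ennreal ((D (p, X))\<^sup>2) * h (D (p, X)) \<partial>\<mu>)
          = c * (\<integral>\<^sup>+X. ennreal ((D (p, X))\<^sup>2) * h (D (p, X)) \<partial>\<mu>)"
        by (subst nn_integral_cmult[symmetric]) (simp_all add: mult.assoc)
    qed
    finally show ?thesis by (simp add: sum_distrib_left D_def case_prod_beta)
  qed
  \<comment> \<open>\<open>measure_of\<close> yields the zero measure unless its set function is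
    countably additive. Agreement with \<open>emeasure M\<close> on the whole sigma-algebra settles
    this.\<close>
  have "pair_distance_measure N \<mu> = measure_of (space M) (sets M) (emeasure M)"
    proof -
    have sM: "space M = {0..}" "sets M = sets B"
      by (simp_all add: M_def B_def space_restrict_space)
    have spB: "space B = {0..}" by (simp add: B_def space_restrict_space)
    show ?thesis unfolding pair_distance_measure_def
      unfolding sM B_def[symmetric]
    proof (rule measure_of_eq)
      show "sets B \<subseteq> Pow {0..}" using sets.space_closed[of B] by (simp add: spB)
      fix A assume "A \<in> sigma_sets {0..} (sets B)"
      then have A: "A \<in> sets B" using sets.sigma_sets_eq[of B] by (simp add: spB)
      have "emeasure M A = (\<integral>\<^sup>+r. indicator A r \<partial>M)" using A sM by simp
      also have "\<dots> = c * (\<Sum>(i, j)\<in>ordered_pairs N.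
        \<integral>\<^sup>+X. ennreal ((sphere_dist (X i) (X j))\<^sup>2) * indicator A (sphere_dist (X i) (X j)) \<partial>\<mu>)"
        using A by (intro *) simp
      also have "\<dots> = c * (\<Sum>(i, j)\<in>ordered_pairs N.
        \<integral>\<^sup>+X\<in>{X \<in> space \<mu>. sphere_dist (X i) (X j) \<in> A}. ennreal ((sphere_dist (X i) (X j))\<^sup>2) \<partial>\<mu>)"
        by (intro arg_cong2[where f="(*)"] sum.cong refl)
           (auto intro!: nn_integral_cong split: split_indicator)
      finally show "ennreal (1 / (real N * (real N - 1))) *
          (\<Sum>(i, j)\<in>{(i, j). i < N \<and> j < N \<and> i \<noteq> j}.
             \<integral>\<^sup>+X\<in>{X \<in> space \<mu>. sphere_dist (X i) (X j) \<in> A}.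
               ennreal ((sphere_dist (X i) (X j))\<^sup>2) \<partial>\<mu>) = emeasure M A"
        unfolding c_def ordered_pairs_def by (rule sym)
    qed
  qed
  then have "pair_distance_measure N \<mu> = M" by (simp only: measure_of_of_measure)
  then show ?thesis using *[of g] g by (simp add: B_def c_def)
qed

lemma space_pair_distance_measure: "space (pair_distance_measure N \<mu>) = {0..}"
  and sets_pair_distance_measure: "sets (pair_distance_measure N \<mu>) = sets (restrict_space borel {0..})"
proof -
  have "sets (restrict_space borel {0..}) \<subseteq> Pow {0::real..}"
    using sets.space_closed[of "restrict_space borel {0::real..}"] by (simp add: space_restrict_space)
  moreover have "sigma_sets {0..} (sets (restrict_space borel {0::real..})) = sets (restrict_space borel {0..})"
    using sets.sigma_sets_eq[of "restrict_space borel {0::real..}"] by (simp add: space_restrict_space)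
  ultimately show "space (pair_distance_measure N \<mu>) = {0..}"
    "sets (pair_distance_measure N \<mu>) = sets (restrict_space borel {0..})"
    by (simp_all add: pair_distance_measure_def space_measure_of_conv sets_measure_of)
qed

text \<open>The sigma-algebra of \<open>\<rho>\<close> restricted to \<open>{0..R}\<close> is the
  trace of the Borel sets, so the extension is Borel on the whole line and can be composed with
  distances.\<close>

lemma borel_measurable_extend_by_zero:
  assumes \<phi>: "\<phi> \<in> borel_measurable (restrict_space (pair_distance_measure N \<mu>) {0..R})"
  shows "extend_by_zero R \<phi> \<in> borel_measurable borel"
proof -
  have "sets (restrict_space (pair_distance_measure N \<mu>) {0..R})
      = sets (restrict_space (restrict_space borel {0..}) {0..R})"
    by (rule sets_restrict_space_cong) (rule sets_pair_distance_measure)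
  also have "\<dots> = sets (restrict_space borel {0..R})"
    by (simp add: restrict_restrict_space Int_absorb1 subset_iff)
  finally have "\<phi> \<in> borel_measurable (restrict_space borel {0..R})"
    using \<phi> by (simp cong: measurable_cong_sets)
  then have "(\<lambda>x. indicator {0..R} x *\<^sub>R \<phi> x) \<in> borel_measurable borel"
    by (subst (asm) borel_measurable_restrict_space_iff) auto
  also have "(\<lambda>x. indicator {0..R} x *\<^sub>R \<phi> x) = extend_by_zero R \<phi>"
    by (auto simp: extend_by_zero_def fun_eq_iff)
  finally show ?thesis .
qed

subsection \<open>The norm of the interaction field\<close>

text \<open>The contribution of one ordered pair to the squared norm of \<open>\<phi>\<close>, and
  almost everywhere the squared length of the corresponding force.\<close>

definition pair_energy ::
    "real \<Rightarrow> (real \<Rightarrow> real) \<Rightarrow> nat \<Rightarrow> nat \<Rightarrow> (nat \<Rightarrow> 'a::euclidean_space) \<Rightarrow> real" where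
  "pair_energy R \<phi> i j X =
    (extend_by_zero R \<phi> (sphere_dist (X i) (X j)))\<^sup>2 * (sphere_dist (X i) (X j))\<^sup>2"

context
  fixes N :: nat and R :: real and \<phi> :: "real \<Rightarrow> real"
    and \<mu> :: "(nat \<Rightarrow> 'a::euclidean_space) measure" and \<rho> :: "real measure"
  assumes dim: "DIM('a) \<ge> 2" and N: "N \<ge> 2"
    and \<mu>_def: "\<mu> = uniform_sphere_power N"
    and \<rho>_def: "\<rho> = pair_distance_measure N \<mu>"
    and \<phi>: "\<phi> \<in> L2_space R \<rho>"
begin

lemma norm_\<mu>: "X \<in> space \<mu> \<Longrightarrow> i < N \<Longrightarrow> norm (X i) = 1"
  by (simp add: \<mu>_def norm_uniform_sphere_power)

lemma borel_measurable_ext: "extend_by_zero R \<phi> \<in> borel_measurable borel"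
  using \<phi> borel_measurable_extend_by_zero unfolding L2_space_def \<rho>_def by blast

lemma borel_measurable_dist: "i < N \<Longrightarrow> j < N \<Longrightarrow> (\<lambda>X. sphere_dist (X i) (X j)) \<in> borel_measurable \<mu>"
  unfolding \<mu>_def by (rule borel_measurable_sphere_dist_power)

lemma borel_measurable_ext_dist:
  "i < N \<Longrightarrow> j < N \<Longrightarrow> (\<lambda>X. extend_by_zero R \<phi> (sphere_dist (X i) (X j))) \<in> borel_measurable \<mu>"
  using borel_measurable_dist borel_measurable_ext by (rule measurable_compose)

lemma borel_measurable_pair_energy:
  assumes "i < N" "j < N"
  shows "pair_energy R \<phi> i j \<in> borel_measurable \<mu>"
proof -
  note [measurable] = borel_measurable_dist[OF assms] borel_measurable_ext_dist[OF assms]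
  have "(\<lambda>X. pair_energy R \<phi> i j X) \<in> borel_measurable \<mu>" unfolding pair_energy_def by measurable
  then show ?thesis by simp
qed

text \<open>Stated in the extended nonnegative reals, so that it is available before the
  integrability of the single terms, which is derived from it.\<close>

lemma nn_integral_sq_L2:
  "(\<integral>\<^sup>+r. ennreal ((\<phi> r)\<^sup>2) \<partial>restrict_space \<rho> {0..R}) =
    ennreal (1 / (real N * (real N - 1))) *
      (\<Sum>(i, j)\<in>ordered_pairs N. \<integral>\<^sup>+X. ennreal (pair_energy R \<phi> i j X) \<partial>\<mu>)"
proof -
  have "{0..R} \<inter> {0..} \<in> sets \<rho>"
    unfolding \<rho>_def sets_pair_distance_measure by (auto simp: sets_restrict_space)
  then have "(\<integral>\<^sup>+r. ennreal ((\<phi> r)\<^sup>2) \<partial>restrict_space \<rho> {0..R}) =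
      (\<integral>\<^sup>+r. ennreal ((\<phi> r)\<^sup>2) * indicator {0..R} r \<partial>\<rho>)"
    by (intro nn_integral_restrict_space) (simp add: \<rho>_def space_pair_distance_measure)
  also have "\<dots> = (\<integral>\<^sup>+r. ennreal ((extend_by_zero R \<phi> r)\<^sup>2) \<partial>\<rho>)"
    by (intro nn_integral_cong) (auto simp: extend_by_zero_def split: split_indicator)
  also have "\<dots> = ennreal (1 / (real N * (real N - 1))) *
      (\<Sum>(i, j)\<in>ordered_pairs N. \<integral>\<^sup>+X. ennreal ((sphere_dist (X i) (X j))\<^sup>2) *
        ennreal ((extend_by_zero R \<phi> (sphere_dist (X i) (X j)))\<^sup>2) \<partial>\<mu>)"
  proof -
    note [measurable] = borel_measurable_ext
    have "(\<lambda>r. ennreal ((extend_by_zero R \<phi> r)\<^sup>2)) \<in> borel_measurable borel" by measurable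
    then show ?thesis
      unfolding \<rho>_def \<mu>_def by (intro nn_integral_pair_distance_measure measurable_restrict_space1)
  qed
  also have "\<dots> = ennreal (1 / (real N * (real N - 1))) *
      (\<Sum>(i, j)\<in>ordered_pairs N. \<integral>\<^sup>+X. ennreal (pair_energy R \<phi> i j X) \<partial>\<mu>)"
    by (simp add: pair_energy_def ennreal_mult mult.commute)
  finally show ?thesis .
qed

text \<open>For distinct indices the integral is one nonnegative summand of a finite sum; for equal
  indices the distance, and with it the integrand, is 0.\<close>

lemma integrable_pair_energy:
  assumes ij: "i < N" "j < N"
  shows "integrable \<mu> (pair_energy R \<phi> i j)"
proof (cases "i = j")
  case True
  have "integrable \<mu> (\<lambda>_. 0 :: real)" by simp
  also have "?this \<longleftrightarrow> ?thesis"
    using True ij by (intro Bochner_Integration.integrable_cong) (auto simp: pair_energy_def sphere_dist_self norm_\<mu>)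
  finally show ?thesis .
next
  case False
  have "integrable (restrict_space \<rho> {0..R}) (\<lambda>r. (\<phi> r)\<^sup>2)"
    using \<phi> by (simp add: L2_space_def)
  then have fin: "(\<integral>\<^sup>+r. ennreal ((\<phi> r)\<^sup>2) \<partial>restrict_space \<rho> {0..R}) < \<infinity>"
    by (simp add: integrable_iff_bounded)
  have "ennreal (1 / (real N * (real N - 1))) \<noteq> 0" using N by simp
  then have "(\<Sum>p\<in>ordered_pairs N. case p of (i, j) \<Rightarrow> \<integral>\<^sup>+X. ennreal (pair_energy R \<phi> i j X) \<partial>\<mu>) < \<infinity>"
    using fin unfolding nn_integral_sq_L2 by (auto simp: ennreal_mult_less_top)
  moreover have "(\<integral>\<^sup>+X. ennreal (pair_energy R \<phi> i j X) \<partial>\<mu>)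
      \<le> (\<Sum>p\<in>ordered_pairs N. case p of (i, j) \<Rightarrow> \<integral>\<^sup>+X. ennreal (pair_energy R \<phi> i j X) \<partial>\<mu>)"
    using member_le_sum[of "(i, j)" "ordered_pairs N"
        "\<lambda>(i, j). \<integral>\<^sup>+X. ennreal (pair_energy R \<phi> i j X) \<partial>\<mu>"] False ij finite_ordered_pairs
    by (simp add: ordered_pairs_def)
  ultimately have "(\<integral>\<^sup>+X. ennreal (pair_energy R \<phi> i j X) \<partial>\<mu>) < \<infinity>"
    by (rule le_less_trans[rotated])
  moreover have "norm (pair_energy R \<phi> i j X) = pair_energy R \<phi> i j X" for X :: "nat \<Rightarrow> 'a"
    by (simp add: pair_energy_def)
  ultimately show ?thesis
    using borel_measurable_pair_energy[OF ij] by (simp add: integrable_iff_bounded)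
qed

lemma L2_norm_sq:
  "(L2_norm R \<rho> \<phi>)\<^sup>2 =
    (\<Sum>(i, j)\<in>ordered_pairs N. \<integral>X. pair_energy R \<phi> i j X \<partial>\<mu>) / (real N * (real N - 1))"
proof -
  have nn: "0 \<le> (\<integral>X. pair_energy R \<phi> i j X \<partial>\<mu>)" for i j
    by (rule Bochner_Integration.integral_nonneg) (simp add: pair_energy_def)
  have "(\<integral>\<^sup>+X. ennreal (pair_energy R \<phi> i j X) \<partial>\<mu>) = ennreal (\<integral>X. pair_energy R \<phi> i j X \<partial>\<mu>)"
    if "i < N" "j < N" for i j
    by (intro nn_integral_eq_integral integrable_pair_energy that AE_I2) (simp add: pair_energy_def)
  then have "(\<Sum>(i, j)\<in>ordered_pairs N. \<integral>\<^sup>+X. ennreal (pair_energy R \<phi> i j X) \<partial>\<mu>)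
      = (\<Sum>(i, j)\<in>ordered_pairs N. ennreal (\<integral>X. pair_energy R \<phi> i j X \<partial>\<mu>))"
    by (intro sum.cong) (auto simp: ordered_pairs_def)
  also have "\<dots> = ennreal (\<Sum>(i, j)\<in>ordered_pairs N. \<integral>X. pair_energy R \<phi> i j X \<partial>\<mu>)"
    using nn by (simp add: case_prod_beta)
  finally have sum: "(\<Sum>(i, j)\<in>ordered_pairs N. \<integral>\<^sup>+X. ennreal (pair_energy R \<phi> i j X) \<partial>\<mu>)
      = ennreal (\<Sum>(i, j)\<in>ordered_pairs N. \<integral>X. pair_energy R \<phi> i j X \<partial>\<mu>)" .
  have nns: "0 \<le> (\<Sum>(i, j)\<in>ordered_pairs N. \<integral>X. pair_energy R \<phi> i j X \<partial>\<mu>)"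
    using nn by (intro sum_nonneg) auto
  have c: "0 \<le> 1 / (real N * (real N - 1))" using N by simp
  have int: "integrable (restrict_space \<rho> {0..R}) (\<lambda>r. (\<phi> r)\<^sup>2)"
    using \<phi> by (simp add: L2_space_def)
  have "ennreal (\<integral>r. (\<phi> r)\<^sup>2 \<partial>restrict_space \<rho> {0..R})
      = (\<integral>\<^sup>+r. ennreal ((\<phi> r)\<^sup>2) \<partial>restrict_space \<rho> {0..R})"
    using int by (intro nn_integral_eq_integral[symmetric]) auto
  also have "\<dots> = ennreal (1 / (real N * (real N - 1)) *
      (\<Sum>(i, j)\<in>ordered_pairs N. \<integral>X. pair_energy R \<phi> i j X \<partial>\<mu>))"
    unfolding nn_integral_sq_L2 sum by (rule ennreal_mult[OF c nns, symmetric])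
  finally have "(\<integral>r. (\<phi> r)\<^sup>2 \<partial>restrict_space \<rho> {0..R}) = 1 / (real N * (real N - 1)) *
      (\<Sum>(i, j)\<in>ordered_pairs N. \<integral>X. pair_energy R \<phi> i j X \<partial>\<mu>)"
    using c nns by (subst (asm) ennreal_inj) (auto intro!: mult_nonneg_nonneg)
  moreover have "(L2_norm R \<rho> \<phi>)\<^sup>2 = (\<integral>r. (\<phi> r)\<^sup>2 \<partial>restrict_space \<rho> {0..R})"
    unfolding L2_norm_def by (intro real_sqrt_pow2 Bochner_Integration.integral_nonneg) simp
  ultimately show ?thesis by simp
qed

lemma L2_norm_eq_0_iff: "L2_norm R \<rho> \<phi> = 0 \<longleftrightarrow> L2_zero R \<rho> \<phi>"
  using \<phi> integral_nonneg_eq_0_iff_AE[of "restrict_space \<rho> {0..R}" "\<lambda>r. (\<phi> r)\<^sup>2"]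
  by (simp add: L2_norm_def L2_zero_def L2_space_def)

section \<open>Inner products of single forces\<close>

abbreviation force :: "nat \<Rightarrow> nat \<Rightarrow> (nat \<Rightarrow> 'a) \<Rightarrow> 'a" where
  "force i j X \<equiv> extend_by_zero R \<phi> (sphere_dist (X i) (X j)) *\<^sub>R influence_vector (X i) (X j)"

lemma borel_measurable_force: "i < N \<Longrightarrow> j < N \<Longrightarrow> force i j \<in> borel_measurable \<mu>"
  using borel_measurable_ext_dist borel_measurable_influence_vector_power[of i N j]
  unfolding \<mu>_def by (intro borel_measurable_scaleR) simp_all

text \<open>Only an inequality, but valid at every configuration, antipodal pairs included.\<close>

lemma norm_force_sq_le:
  assumes "X \<in> space \<mu>" "i < N" "j < N"
  shows "(norm (force i j X))\<^sup>2 \<le> pair_energy R \<phi> i j X"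
proof -
  have "(norm (influence_vector (X i) (X j)))\<^sup>2 \<le> (sphere_dist (X i) (X j))\<^sup>2"
    using assms by (intro power_mono influence_vector_norm_le norm_\<mu>) auto
  then show ?thesis by (simp add: pair_energy_def power_mult_distrib mult_left_mono)
qed

text \<open>Cauchy-Schwarz and \<open>?a * ?b \<le> ?a\<^sup>2 + ?b\<^sup>2\<close> dominate the
  product by two pair energies.\<close>

lemma integrable_force_inner:
  assumes ijk: "i < N" "j < N" "k < N"
  shows "integrable \<mu> (\<lambda>X. force i j X \<bullet> force i k X)"
proof (rule Bochner_Integration.integrable_bound)
  show "integrable \<mu> (\<lambda>X. pair_energy R \<phi> i j X + pair_energy R \<phi> i k X)"
    using ijk by (intro Bochner_Integration.integrable_add integrable_pair_energy)
  show "(\<lambda>X. force i j X \<bullet> force i k X) \<in> borel_measurable \<mu>"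
    using ijk by (intro borel_measurable_inner borel_measurable_force)
  show "AE X in \<mu>. norm (force i j X \<bullet> force i k X) \<le> norm (pair_energy R \<phi> i j X + pair_energy R \<phi> i k X)"
  proof (rule AE_I2)
    fix X assume X: "X \<in> space \<mu>"
    let ?a = "norm (force i j X)" and ?b = "norm (force i k X)"
    have "\<bar>force i j X \<bullet> force i k X\<bar> \<le> ?a * ?b" by (rule Cauchy_Schwarz_ineq2)
    also have "?a * ?b \<le> ?a\<^sup>2 + ?b\<^sup>2"
      using sum_squares_bound[of ?a ?b] mult_nonneg_nonneg[OF norm_ge_zero norm_ge_zero, of "force i j X" "force i k X"]
      by linarith
    also have "\<dots> \<le> pair_energy R \<phi> i j X + pair_energy R \<phi> i k X"
      using X ijk by (intro add_mono norm_force_sq_le)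
    finally show "norm (force i j X \<bullet> force i k X) \<le> norm (pair_energy R \<phi> i j X + pair_energy R \<phi> i k X)"
      by simp
  qed
qed

text \<open>Reflecting point \<open>k\<close> moves neither point \<open>i\<close> nor point
  \<open>j\<close>, so exactly one factor changes sign.\<close>

lemma integral_force_inner_distinct:
  assumes ijk: "i < N" "j < N" "k < N" and ne: "j \<noteq> k" "i \<noteq> k"
  shows "(\<integral>X. force i j X \<bullet> force i k X \<partial>\<mu>) = 0"
  unfolding \<mu>_def
proof (rule integral_eq_0_if_odd_reflect_coordinate[OF ijk(1,3) ne(2)])
  show "(\<lambda>X. force i j X \<bullet> force i k X) \<in> borel_measurable (uniform_sphere_power N)"
    using ijk unfolding \<mu>_def[symmetric] by (intro borel_measurable_inner borel_measurable_force)
  fix X :: "nat \<Rightarrow> 'a" assume X: "X \<in> space (uniform_sphere_power N)"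
  have n: "norm (X i) = 1" "norm (X k) = 1" using X ijk by (simp_all add: norm_uniform_sphere_power)
  have "reflect_coordinate i k X i = X i" "reflect_coordinate i k X j = X j"
    "reflect_coordinate i k X k = axis_reflection (X i) (X k)"
    using ne by (simp_all add: reflect_coordinate_def)
  then show "force i j (reflect_coordinate i k X) \<bullet> force i k (reflect_coordinate i k X)
      = - (force i j X \<bullet> force i k X)"
    using n by (simp add: sphere_dist_axis_reflection influence_vector_axis_reflection)
qed

lemma integral_force_inner_same:
  assumes ij: "i < N" "j < N" "i \<noteq> j"
  shows "(\<integral>X. force i j X \<bullet> force i j X \<partial>\<mu>) = (\<integral>X. pair_energy R \<phi> i j X \<partial>\<mu>)"
proof (rule integral_cong_AE)
  have "AE X in \<mu>. X j \<noteq> - X i"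
    unfolding \<mu>_def by (rule AE_uniform_sphere_power_not_antipodal[OF dim ij])
  then show "AE X in \<mu>. force i j X \<bullet> force i j X = pair_energy R \<phi> i j X"
  proof (rule AE_mp, intro AE_I2 impI)
    fix X assume "X \<in> space \<mu>" "X j \<noteq> - X i"
    then have "norm (influence_vector (X i) (X j)) = sphere_dist (X i) (X j)"
      using ij by (intro influence_vector_norm norm_\<mu>)
    then have "influence_vector (X i) (X j) \<bullet> influence_vector (X i) (X j) = (sphere_dist (X i) (X j))\<^sup>2"
      by (simp only: power2_norm_eq_inner[symmetric])
    then show "force i j X \<bullet> force i j X = pair_energy R \<phi> i j X"
      by (simp add: pair_energy_def power2_eq_square)
  qed
  show "(\<lambda>X. force i j X \<bullet> force i j X) \<in> borel_measurable \<mu>"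
    using ij by (intro borel_measurable_inner borel_measurable_force)
  show "pair_energy R \<phi> i j \<in> borel_measurable \<mu>"
    using ij by (intro borel_measurable_pair_energy)
qed

text \<open>The nested conditional is shaped for \<open>sum.delta\<close>: the sum over
  \<open>k\<close> collapses to \<open>k = j\<close>, and what remains is a sum over ordered
  pairs.\<close>

lemma integral_force_inner:
  assumes ijk: "i < N" "j < N" "k < N"
  shows "(\<integral>X. force i j X \<bullet> force i k X \<partial>\<mu>)
    = (if k = j then if i = j then 0 else (\<integral>X. pair_energy R \<phi> i j X \<partial>\<mu>) else 0)"
proof -
  consider "i = k" | "i \<noteq> k" "j \<noteq> k" | "i \<noteq> k" "j = k" by blast
  then show ?thesis
  proof cases
    case 1
    then have "(\<lambda>X. force i j X \<bullet> force i k X) = (\<lambda>X. 0)" by (simp add: influence_vector_def)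
    then show ?thesis using 1 by simp
  next
    case 2
    then show ?thesis using integral_force_inner_distinct[OF ijk] by simp
  next
    case 3
    then show ?thesis using integral_force_inner_same[OF ijk(1,2)] by simp
  qed
qed

lemma vector_field_L2_norm_sq:
  "(vector_field_L2_norm N \<mu> (interaction_field N R \<phi>))\<^sup>2 =
    (\<Sum>(i, j)\<in>ordered_pairs N. \<integral>X. pair_energy R \<phi> i j X \<partial>\<mu>) / (real N)^3"
proof -
  have "(tangent_norm N (interaction_field N R \<phi> X))\<^sup>2
      = (\<Sum>i<N. \<Sum>j<N. \<Sum>k<N. force i j X \<bullet> force i k X) / (real N)^3" for X
  proof -
    have "interaction_field N R \<phi> X i \<bullet> interaction_field N R \<phi> X i
        = (\<Sum>j<N. \<Sum>k<N. force i j X \<bullet> force i k X) / (real N)\<^sup>2" for i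
    proof -
      have "interaction_field N R \<phi> X i \<bullet> interaction_field N R \<phi> X i
          = (\<Sum>j<N. force i j X) \<bullet> (\<Sum>k<N. force i k X) / (real N)\<^sup>2"
        by (simp only: interaction_field_def inner_scaleR_left inner_scaleR_right)
           (simp add: power2_eq_square)
      also have "(\<Sum>j<N. force i j X) \<bullet> (\<Sum>k<N. force i k X) = (\<Sum>j<N. \<Sum>k<N. force i j X \<bullet> force i k X)"
        by (simp only: inner_sum_left) (simp only: inner_sum_right)
      finally show ?thesis .
    qed
    moreover have "(tangent_norm N (interaction_field N R \<phi> X))\<^sup>2
        = 1 / real N * (\<Sum>i<N. interaction_field N R \<phi> X i \<bullet> interaction_field N R \<phi> X i)"
      unfolding tangent_norm_def by (intro real_sqrt_pow2 mult_nonneg_nonneg sum_nonneg) auto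
    ultimately have "(tangent_norm N (interaction_field N R \<phi> X))\<^sup>2
        = 1 / real N * (\<Sum>i<N. (\<Sum>j<N. \<Sum>k<N. force i j X \<bullet> force i k X) / (real N)\<^sup>2)"
      by (simp only:)
    also have "\<dots> = (\<Sum>i<N. \<Sum>j<N. \<Sum>k<N. force i j X \<bullet> force i k X) / (real N)^3"
      by (simp only: sum_divide_distrib[symmetric]) (simp add: power2_eq_square power3_eq_cube)
    finally show ?thesis .
  qed
  moreover have "(vector_field_L2_norm N \<mu> (interaction_field N R \<phi>))\<^sup>2
      = (\<integral>X. (tangent_norm N (interaction_field N R \<phi> X))\<^sup>2 \<partial>\<mu>)"
    unfolding vector_field_L2_norm_def
    by (intro real_sqrt_pow2 Bochner_Integration.integral_nonneg) simp
  ultimately have "(vector_field_L2_norm N \<mu> (interaction_field N R \<phi>))\<^sup>2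
      = (\<integral>X. (\<Sum>i<N. \<Sum>j<N. \<Sum>k<N. force i j X \<bullet> force i k X) / (real N)^3 \<partial>\<mu>)"
    by (simp only:)
  also have "\<dots> = (\<integral>X. (\<Sum>i<N. \<Sum>j<N. \<Sum>k<N. force i j X \<bullet> force i k X) \<partial>\<mu>) / (real N)^3"
    by simp
  also have "(\<integral>X. (\<Sum>i<N. \<Sum>j<N. \<Sum>k<N. force i j X \<bullet> force i k X) \<partial>\<mu>)
      = (\<Sum>i<N. \<Sum>j<N. \<Sum>k<N. \<integral>X. force i j X \<bullet> force i k X \<partial>\<mu>)"
  proof -
    have 1: "integrable \<mu> (\<lambda>X. \<Sum>k<N. force i j X \<bullet> force i k X)" if "i < N" "j < N" for i j
      using that by (intro Bochner_Integration.integrable_sum integrable_force_inner) auto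
    have 2: "integrable \<mu> (\<lambda>X. \<Sum>j<N. \<Sum>k<N. force i j X \<bullet> force i k X)" if "i < N" for i
      using that by (intro Bochner_Integration.integrable_sum 1) simp_all
    have "(\<integral>X. (\<Sum>i<N. \<Sum>j<N. \<Sum>k<N. force i j X \<bullet> force i k X) \<partial>\<mu>)
        = (\<Sum>i<N. \<integral>X. (\<Sum>j<N. \<Sum>k<N. force i j X \<bullet> force i k X) \<partial>\<mu>)"
      by (rule Bochner_Integration.integral_sum) (rule 2, simp)
    also have "\<dots> = (\<Sum>i<N. \<Sum>j<N. \<integral>X. (\<Sum>k<N. force i j X \<bullet> force i k X) \<partial>\<mu>)"
      by (intro sum.cong refl Bochner_Integration.integral_sum 1) simp_all
    also have "\<dots> = (\<Sum>i<N. \<Sum>j<N. \<Sum>k<N. \<integral>X. force i j X \<bullet> force i k X \<partial>\<mu>)"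
      by (intro sum.cong refl Bochner_Integration.integral_sum integrable_force_inner) simp_all
    finally show ?thesis .
  qed
  also have "\<dots> = (\<Sum>i<N. \<Sum>j<N. \<Sum>k<N.
      if k = j then if i = j then 0 else (\<integral>X. pair_energy R \<phi> i j X \<partial>\<mu>) else 0)"
    by (intro sum.cong refl integral_force_inner) auto
  also have "\<dots> = (\<Sum>i<N. \<Sum>j<N. if i = j then 0 else (\<integral>X. pair_energy R \<phi> i j X \<partial>\<mu>))"
    by (intro sum.cong refl) (simp add: sum.delta)
  also have "\<dots> = (\<Sum>(i, j)\<in>ordered_pairs N. \<integral>X. pair_energy R \<phi> i j X \<partial>\<mu>)"
    by (rule sum_ordered_pairs[symmetric])
  finally show ?thesis .
qed

lemma L2_norm_ratio:
  assumes "\<not> L2_zero R \<rho> \<phi>"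
  shows "vector_field_L2_norm N \<mu> (interaction_field N R \<phi>) / L2_norm R \<rho> \<phi> = sqrt (real N - 1) / real N"
proof -
  define a where "a = vector_field_L2_norm N \<mu> (interaction_field N R \<phi>)"
  define b where "b = L2_norm R \<rho> \<phi>"
  define S where "S = (\<Sum>(i, j)\<in>ordered_pairs N. \<integral>X. pair_energy R \<phi> i j X \<partial>\<mu>)"
  have a: "a\<^sup>2 = S / (real N)^3" and b: "b\<^sup>2 = S / (real N * (real N - 1))"
    unfolding a_def b_def S_def by (rule vector_field_L2_norm_sq, rule L2_norm_sq)
  have "b \<noteq> 0" using assms L2_norm_eq_0_iff by (simp add: b_def)
  then have "S \<noteq> 0" using b by auto
  \<comment> \<open>The common factor \<open>S\<close> cancels; both sides being nonnegative, their
    squares determine them.\<close>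
  have "(a / b)\<^sup>2 = (sqrt (real N - 1) / real N)\<^sup>2"
    using N \<open>S \<noteq> 0\<close> by (simp add: power_divide a b) (simp add: power2_eq_square power3_eq_cube)
  moreover have "a / b \<ge> 0"
    by (simp add: a_def b_def vector_field_L2_norm_def L2_norm_def)
  moreover have "sqrt (real N - 1) / real N \<ge> 0" using N by simp
  ultimately have "a / b = sqrt (real N - 1) / real N" by (rule power2_eq_imp_eq)
  then show ?thesis by (simp add: a_def b_def)
qed

end

theorem proposition4p3:
  fixes n N :: nat and R :: real
    and \<mu> :: "(nat \<Rightarrow> 'a::euclidean_space) measure"
    and \<rho> :: "real measure"
    and H :: "(real \<Rightarrow> real) set"
  assumes "DIM('a) = n + 1" and "n \<ge> 1"
    and "N \<ge> 2" and "R > 0"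
    and "\<mu> = uniform_sphere_power N"
    and "\<rho> = pair_distance_measure N \<mu>"
    and "L2_subspace R \<rho> H" and "\<exists>\<phi>\<in>H. \<not> L2_zero R \<rho> \<phi>"
  shows "(INF \<phi>\<in>{\<phi> \<in> H. \<not> L2_zero R \<rho> \<phi>}.
            vector_field_L2_norm N \<mu> (interaction_field N R \<phi>) / L2_norm R \<rho> \<phi>)
         = sqrt (real N - 1) / real N"
proof -
  have "vector_field_L2_norm N \<mu> (interaction_field N R \<phi>) / L2_norm R \<rho> \<phi> = sqrt (real N - 1) / real N"
    if "\<phi> \<in> {\<phi> \<in> H. \<not> L2_zero R \<rho> \<phi>}" for \<phi>
    using that assms by (intro L2_norm_ratio) (auto simp: L2_subspace_def)
  then have "(INF \<phi>\<in>{\<phi> \<in> H. \<not> L2_zero R \<rho> \<phi>}.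
            vector_field_L2_norm N \<mu> (interaction_field N R \<phi>) / L2_norm R \<rho> \<phi>)
      = (INF \<phi>\<in>{\<phi> \<in> H. \<not> L2_zero R \<rho> \<phi>}. sqrt (real N - 1) / real N)"
    by (intro INF_cong refl)
  \<comment> \<open>Nontriviality of \<open>H\<close> makes the index set nonempty, as the infimum
    of a constant requires.\<close>
  also have "\<dots> = sqrt (real N - 1) / real N"
    using assms(8) by (intro cINF_const) auto
  finally show ?thesis .
qed

end
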